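(* Let $K$ be a number field with ring of integers $\mathcal{O}_K$, and let $\mathcal{R}_K$ be a chosen unique factorization domain with $\mathcal{O}_K\subset\mathcal{R}_K\subset K$ whose group of units is finitely generated (if $K$ has class number one, $\mathcal{R}_K=\mathcal{O}_K$). Let $A,B,C\in\mathcal{R}_K[t]$ and let $E:y^2=x^3+Ax^2+Bx+C$ be a nonconstant elliptic curve over $K(t)$ having exactly one nontrivial $2$-torsion point over $K(t)$; i.e. $x^3+Ax^2+Bx+C=(x-e_1)(x-e)(x-\bar e)$ with $e_1\in\mathcal{R}_K[t]$ and $e,\bar e$ conjugate over $K(t)$ (not in $K(t)$). Let $t_0\in K$ satisfy: for every nonconstant square-free divisor $h$ in $\mathcal{R}_K[t]$ of $e_1^2-(e+\bar e)e_1+e\bar e$ or of $(e-\bar e)^2$, the number $h(t_0)$ is not a square in $K$. Then the specialized curve $E_{t_0}$ is an elliptic curve over $K$ and the specialization homomorphism $\sigma_{t_0}:E(K(t))\to E_{t_0}(K)$ is injective.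
   Context: An elliptic curve over $K(t)$ is called nonconstant if it is not isomorphic over $K(t)$ to an elliptic curve defined over $K$. $E_{t_0}$ is the curve over $K$ obtained by substituting $t=t_0$; the specialization homomorphism $\sigma_{t_0}$ sends a point to the point obtained by substituting $t=t_0$ (points reducing to infinity go to the neutral element $O$). *)

theory Defs
  imports
    "HOL-Computational_Algebra.Computational_Algebra"
    "HOL-Algebra.Generated_Groups"
    "HOL-Algebra.Ideal"
begin

section \<open>Number fields and the coefficient ring\<close>

definition number_field :: "'k::field_char_0 itself \<Rightarrow> bool" where
  "number_field _ \<longleftrightarrow>
     (\<exists>B :: 'k set. finite B \<and> module.span (\<lambda>(q::rat) x. of_rat q * x) B = UNIV)"

definition integer_ring :: "'k::field_char_0 ring" where
  "integer_ring =
     \<lparr>carrier = {x. algebraic_int x}, mult = (*), one = 1, zero = 0, add = (+)\<rparr>"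

definition class_number :: "'k::field_char_0 itself \<Rightarrow> nat" where
  "class_number _ =
     card ({I. ideal I (integer_ring :: 'k ring) \<and> I \<noteq> {0}} //
           {(I, J). ideal I (integer_ring :: 'k ring) \<and> I \<noteq> {0} \<and>
                    ideal J (integer_ring :: 'k ring) \<and> J \<noteq> {0} \<and>
                    (\<exists>a \<in> carrier integer_ring. \<exists>b \<in> carrier integer_ring.
                       a \<noteq> 0 \<and> b \<noteq> 0 \<and> (*) a ` I = (*) b ` J)})"

text \<open>
  Subrings and field extensions are given by an embedding of a type into a larger type. A unique
  factorization domain inside a field \<open>'k\<close> is a type of the sort \<open>factorial_ring_gcd\<close> and
  \<open>semiring_gcd_mult_normalize\<close> embedded into \<open>'k\<close>. These classes also fix gcds and a
  multiplicative choice of representatives of the association classes. Every unique factorization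
  domain admits such choices, and no definition below depends on them.
\<close>

definition ring_embedding :: "('a::comm_ring_1 \<Rightarrow> 'b::comm_ring_1) \<Rightarrow> bool" where
  "ring_embedding f \<longleftrightarrow> f 1 = 1 \<and> (\<forall>x y. f (x + y) = f x + f y) \<and>
     (\<forall>x y. f (x * y) = f x * f y) \<and> inj f"

definition unit_group :: "'a::comm_ring_1 monoid" where
  "unit_group = \<lparr>carrier = {u. u dvd 1}, mult = (*), one = 1\<rparr>"

definition finitely_generated_group :: "('a, 'b) monoid_scheme \<Rightarrow> bool" where
  "finitely_generated_group G \<longleftrightarrow>
     (\<exists>S. finite S \<and> S \<subseteq> carrier G \<and> generate G S = carrier G)"


section \<open>The rational function field and substitution\<close>

text \<open>\<open>'k poly fract\<close> is the field of rational functions in \<open>t\<close> over \<open>'k\<close>.\<close>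

definition ratfun :: "('r::comm_ring_1 \<Rightarrow> 'k::field) \<Rightarrow> 'r poly \<Rightarrow> 'k poly fract" where
  "ratfun \<iota> p = to_fract (map_poly \<iota> p)"

definition const_ratfun :: "'k::field \<Rightarrow> 'k poly fract" where
  "const_ratfun c = to_fract [:c:]"

definition regular_at :: "'k::field \<Rightarrow> 'k poly fract \<Rightarrow> bool" where
  "regular_at t0 f \<longleftrightarrow> (\<exists>p q. f = Fract p q \<and> poly q t0 \<noteq> 0)"

text \<open>The value is unspecified if \<open>f\<close> has a pole at \<open>t0\<close>.\<close>

definition subst_at :: "'k::field \<Rightarrow> 'k poly fract \<Rightarrow> 'k" where
  "subst_at t0 f =
     (THE v. \<exists>p q. f = Fract p q \<and> poly q t0 \<noteq> 0 \<and> v = poly p t0 / poly q t0)"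

lemma subst_at_Fract:
  assumes "poly q t0 \<noteq> 0"
  shows "subst_at t0 (Fract p q) = poly p t0 / poly q t0"
  unfolding subst_at_def
proof (rule the_equality)
  show "\<exists>p' q'. Fract p q = Fract p' q' \<and> poly q' t0 \<noteq> 0 \<and>
          poly p t0 / poly q t0 = poly p' t0 / poly q' t0"
    using assms by blast
next
  fix v
  assume "\<exists>p' q'. Fract p q = Fract p' q' \<and> poly q' t0 \<noteq> 0 \<and> v = poly p' t0 / poly q' t0"
  then obtain p' q' where *: "Fract p q = Fract p' q'" "poly q' t0 \<noteq> 0"
    "v = poly p' t0 / poly q' t0" by blast
  have "q \<noteq> 0" "q' \<noteq> 0" using assms * by auto
  then have "p * q' = p' * q" using * by (simp add: eq_fract)
  then have "poly p t0 * poly q' t0 = poly p' t0 * poly q t0"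
    by (metis poly_mult)
  then show "v = poly p t0 / poly q t0"
    using assms *(2) by (simp add: *(3) frac_eq_eq)
qed


section \<open>Elliptic curves in Weierstrass form\<close>

text \<open>\<open>Weierstrass a1 a2 a3 a4 a6\<close> is the curve
  \<open>y\<^sup>2 + a1 x y + a3 y = x\<^sup>3 + a2 x\<^sup>2 + a4 x + a6\<close>.\<close>

datatype 'a weierstrass =
  Weierstrass (wa1: 'a) (wa2: 'a) (wa3: 'a) (wa4: 'a) (wa6: 'a)

definition cubic_curve :: "'a::field \<Rightarrow> 'a \<Rightarrow> 'a \<Rightarrow> 'a weierstrass" where
  "cubic_curve a b c = Weierstrass 0 a 0 b c"

definition ec_disc :: "'a::field weierstrass \<Rightarrow> 'a" where
  "ec_disc W =
     (let b2 = (wa1 W)^2 + 4 * wa2 W;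
          b4 = 2 * wa4 W + wa1 W * wa3 W;
          b6 = (wa3 W)^2 + 4 * wa6 W;
          b8 = (wa1 W)^2 * wa6 W + 4 * wa2 W * wa6 W - wa1 W * wa3 W * wa4 W
               + wa2 W * (wa3 W)^2 - (wa4 W)^2
      in - (b2^2 * b8) - 8 * b4^3 - 27 * b6^2 + 9 * b2 * b4 * b6)"

definition elliptic_curve :: "'a::field weierstrass \<Rightarrow> bool" where
  "elliptic_curve W \<longleftrightarrow> ec_disc W \<noteq> 0"

text \<open>
  The isomorphisms of elliptic curves in Weierstrass form over a field are the substitutions
  \<open>x = u\<^sup>2 x' + r\<close>, \<open>y = u\<^sup>3 y' + s u\<^sup>2 x' + t\<close> with \<open>u \<noteq> 0\<close>; the equations below express the
  coefficients of the new curve.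
\<close>

definition ec_isomorphic :: "'a::field weierstrass \<Rightarrow> 'a weierstrass \<Rightarrow> bool" where
  "ec_isomorphic W W' \<longleftrightarrow> (\<exists>u r s t. u \<noteq> 0 \<and>
     u * wa1 W' = wa1 W + 2 * s \<and>
     u^2 * wa2 W' = wa2 W - s * wa1 W + 3 * r - s^2 \<and>
     u^3 * wa3 W' = wa3 W + r * wa1 W + 2 * t \<and>
     u^4 * wa4 W' = wa4 W - s * wa3 W + 2 * r * wa2 W - (t + r * s) * wa1 W
                    + 3 * r^2 - 2 * s * t \<and>
     u^6 * wa6 W' = wa6 W + r * wa4 W + r^2 * wa2 W + r^3 - t * wa3 W - t^2
                    - r * t * wa1 W)"

definition nonconstant_curve :: "'k::field poly fract weierstrass \<Rightarrow> bool" where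
  "nonconstant_curve W \<longleftrightarrow>
     \<not> (\<exists>W0 :: 'k weierstrass. elliptic_curve W0 \<and>
          ec_isomorphic W (map_weierstrass const_ratfun W0))"

datatype 'a ec_point = Neutral | Point 'a 'a

definition ec_points :: "'a::field weierstrass \<Rightarrow> 'a ec_point set" where
  "ec_points W = insert Neutral
     {Point x y | x y. y^2 + wa1 W * x * y + wa3 W * y = x^3 + wa2 W * x^2 + wa4 W * x + wa6 W}"

text \<open>
  Chord and tangent law: \<open>y = l x + n\<close> is the line through both points, tangent if they
  coincide.
\<close>

fun ec_add :: "'a::field weierstrass \<Rightarrow> 'a ec_point \<Rightarrow> 'a ec_point \<Rightarrow> 'a ec_point" where
  "ec_add W Neutral P = P"
| "ec_add W P Neutral = P"
| "ec_add W (Point x1 y1) (Point x2 y2) =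
     (if x1 = x2 \<and> y1 + y2 + wa1 W * x2 + wa3 W = 0 then Neutral
      else
        let l = (if x1 = x2
                 then (3 * x1^2 + 2 * wa2 W * x1 + wa4 W - wa1 W * y1)
                        / (2 * y1 + wa1 W * x1 + wa3 W)
                 else (y2 - y1) / (x2 - x1));
            n = y1 - l * x1;
            x3 = l^2 + wa1 W * l - wa2 W - x1 - x2;
            y3 = - (l + wa1 W) * x3 - n - wa3 W
        in Point x3 y3)"

definition ec_group :: "'a::field weierstrass \<Rightarrow> 'a ec_point monoid" where
  "ec_group W = \<lparr>carrier = ec_points W, mult = ec_add W, one = Neutral\<rparr>"

definition nontrivial_two_torsion :: "'a::field weierstrass \<Rightarrow> 'a ec_point set" where
  "nontrivial_two_torsion W = {T \<in> ec_points W. T \<noteq> Neutral \<and> ec_add W T T = Neutral}"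


section \<open>Specialization\<close>

definition specialized_curve :: "'k::field \<Rightarrow> 'k poly fract weierstrass \<Rightarrow> 'k weierstrass" where
  "specialized_curve t0 W = map_weierstrass (subst_at t0) W"

fun specialization :: "'k::field \<Rightarrow> 'k poly fract ec_point \<Rightarrow> 'k ec_point" where
  "specialization t0 Neutral = Neutral"
| "specialization t0 (Point x y) =
     (if regular_at t0 x \<and> regular_at t0 y then Point (subst_at t0 x) (subst_at t0 y)
      else Neutral)"


section \<open>Conjugate elements and divisors\<close>

text \<open>
  Here \<open>j\<close> embeds the base field into an extension field. For algebraic elements the definition
  says that they have the same minimal polynomial over the base field.
\<close>

definition conjugate_over :: "('a::field \<Rightarrow> 'l::field) \<Rightarrow> 'l \<Rightarrow> 'l \<Rightarrow> bool" where
  "conjugate_over j x y \<longleftrightarrow>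
     (\<forall>p. poly (map_poly j p) x = 0 \<longleftrightarrow> poly (map_poly j p) y = 0)"

text \<open>
  \<open>h\<close> divides, in the polynomial ring over \<open>'r\<close>, the element \<open>z\<close> of an extension of the rational
  function field: \<open>z = h q\<close> for some polynomial \<open>q\<close> over \<open>'r\<close>.
\<close>

definition poly_divides ::
    "('r::comm_ring_1 \<Rightarrow> 'k::field) \<Rightarrow> ('k poly fract \<Rightarrow> 'l::field) \<Rightarrow> 'r poly \<Rightarrow> 'l \<Rightarrow> bool" where
  "poly_divides \<iota> j h z \<longleftrightarrow> (\<exists>q. z = j (ratfun \<iota> (h * q)))"

end

theory Submission
  imports Defs
begin

text \<open>
  Write \<open>S = e + ebar\<close>, \<open>N = e ebar\<close>, \<open>\<beta> = e1\<^sup>2 - S e1 + N\<close> and \<open>d = S\<^sup>2 - 4 N\<close>; all of these lie in \<open>R[t]\<close>, a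
  unique factorization domain with \<open>Frac R = K\<close>. A point that specializes to the neutral element
  is \<open>(p / q\<^sup>2, r / q\<^sup>3)\<close> with coprime \<open>p, q \<in> R[t]\<close> and \<open>q(t0) = 0\<close>, so \<open>p(t0)\<close> is a nonzero square.
  The square-free part of \<open>p - e1 q\<^sup>2\<close> divides \<open>\<beta>\<close> and has a square value at \<open>t0\<close>, hence is a constant
  square by hypothesis; the same argument, with \<open>d\<close> in place of \<open>\<beta>\<close>, applies to the second
  quantity that has to be a square for the point to be divisible by \<open>2\<close>. The explicit half has
  the same denominator \<open>q\<close> before cancellation and again specializes to the neutral element. If
  \<open>q\<close> has the least number of prime factors, then no cancellation ever occurs, and repeated halving
  produces infinitely many points with \<open>p - e1 q\<^sup>2\<close> dividing \<open>\<beta>\<close>. These are too few up to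
  units, so the kernel is trivial.
\<close>

section \<open>Multiplicities and the homogeneous cubic\<close>

text \<open>Primes of odd multiplicity in \<open>a\<close> divide its square-free part exactly once,
  all others not at all; by hypothesis the odd ones divide \<open>d\<close>.\<close>

lemma squarefree_part_dvd:
  fixes a d :: "'a::factorial_ring_gcd"
  assumes "d \<noteq> 0" and "\<And>p. prime p \<Longrightarrow> \<not> p dvd d \<Longrightarrow> even (multiplicity p a)"
  shows "squarefree_part a dvd d"
proof (rule multiplicity_le_imp_dvd)
  fix p :: 'a
  assume p: "prime p"
  show "multiplicity p (squarefree_part a) \<le> multiplicity p d"
  proof (cases "p dvd d")
    case True
    then have "multiplicity p d \<ge> 1"
      using p assms(1) by (simp add: Suc_leI prime_multiplicity_gt_zero_iff)
    then show ?thesis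
      using prime_multiplicity_squarefree_part_le_Suc_0[OF p, of a] by simp
  next
    case False
    have "odd (multiplicity p a)" if "multiplicity p (squarefree_part a) \<noteq> 0"
      using that p by (auto simp: prime_multiplicity_squarefree_part odd_iff_mod_2_eq_one split: if_splits)
    then show ?thesis using assms(2)[OF p False] by fastforce
  qed
qed simp

text \<open>For the multiplicity m of \<open>p\<close> in \<open>r\<close>, 2 m \<ge> 3 forces m
  \<ge> 2: rounding up gains a factor. The next lemma does the same with 3 m \<ge> 4.\<close>

lemma dvd_of_pow3_dvd_square:
  fixes p r :: "'a::factorial_ring_gcd"
  assumes p: "prime p" and "p ^ 3 dvd r\<^sup>2"
  shows "p\<^sup>2 dvd r"
proof (cases "r = 0")
  case False
  have "3 \<le> multiplicity p (r\<^sup>2)"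
    using assms False by (simp add: multiplicity_geI prime_def prime_elem_def)
  then have "2 \<le> multiplicity p r"
    using p False by (simp add: prime_elem_multiplicity_power_distrib)
  then show ?thesis by (rule multiplicity_dvd')
qed simp

lemma dvd_of_pow4_dvd_cube:
  fixes p r :: "'a::factorial_ring_gcd"
  assumes p: "prime p" and "p ^ 4 dvd r ^ 3"
  shows "p\<^sup>2 dvd r"
proof (cases "r = 0")
  case False
  have "4 \<le> multiplicity p (r ^ 3)"
    using assms False by (simp add: multiplicity_geI prime_def prime_elem_def)
  then have "2 \<le> multiplicity p r"
    using p False by (simp add: prime_elem_multiplicity_power_distrib)
  then show ?thesis by (rule multiplicity_dvd')
qed simp

text \<open>\<open>S\<close> and \<open>N\<close> are the sum and the product of the two conjugate roots, and \<open>hcubic e1 S N p q\<close> is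
  \<open>q\<^sup>6\<close> times the value of the cubic at \<open>p / q\<^sup>2\<close>.\<close>

definition hcubic :: "'a::comm_ring_1 \<Rightarrow> 'a \<Rightarrow> 'a \<Rightarrow> 'a \<Rightarrow> 'a \<Rightarrow> 'a" where
  "hcubic e1 S N p q = (p - e1 * q\<^sup>2) * (p\<^sup>2 - S * p * q\<^sup>2 + N * q ^ 4)"

text \<open>Weighted homogeneity of degree 6, with weight 2 for \<open>p\<close> and weight 1 for
  \<open>q\<close>.\<close>

lemma hcubic_scale: "hcubic e1 S N (c\<^sup>2 * p) (c * q) = c ^ 6 * hcubic e1 S N p q"
  unfolding hcubic_def by (simp add: algebra_simps eval_nat_numeral)

text \<open>Modulo \<open>q\<close> the form is \<open>p ^ 3\<close>. This serves to cancel powers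
  of \<open>q\<close> in divisibility relations.\<close>

lemma coprime_hcubic:
  fixes p q :: "'a::ring_gcd"
  assumes "coprime p q"
  shows "coprime (hcubic e1 S N p q) q"
proof -
  have "hcubic e1 S N p q =
      p ^ 3 + q * (q * (N * q\<^sup>2 * p - S * p\<^sup>2 - e1 * (p\<^sup>2 - S * p * q\<^sup>2 + N * q ^ 4)))"
    unfolding hcubic_def by (simp add: algebra_simps eval_nat_numeral)
  moreover have "coprime (p ^ 3) q" using assms by simp
  ultimately show ?thesis
    by (metis coprime_iff_gcd_eq_1 gcd.commute gcd_add_mult add.commute mult.commute)
qed

text \<open>Divisibility is raised in turns: first \<open>\<pi>\<^sup>2\<close> divides
  \<open>r\<close>, then \<open>\<pi>\<^sup>2\<close> divides \<open>p\<close>, and homogeneity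
  finally gives \<open>\<pi> ^ 3\<close> in \<open>r\<close>.\<close>

lemma hcubic_reduce:
  fixes \<pi> :: "'a::factorial_ring_gcd"
  assumes \<pi>: "prime \<pi>" "\<pi> dvd p" "\<pi> dvd q" and r: "r\<^sup>2 = hcubic e1 S N p q"
  obtains p' q' r' where "p = \<pi>\<^sup>2 * p'" "q = \<pi> * q'" "r = \<pi> ^ 3 * r'"
    "r'\<^sup>2 = hcubic e1 S N p' q'"
proof -
  obtain p0 q' where p0: "p = \<pi> * p0" "q = \<pi> * q'" using \<pi> by (auto elim!: dvdE)
  have "r\<^sup>2 = \<pi> ^ 3 * ((p0 - e1 * \<pi> * q'\<^sup>2) * (p0\<^sup>2 - S * p0 * \<pi> * q'\<^sup>2 + N * \<pi>\<^sup>2 * q' ^ 4))"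
    unfolding r p0 hcubic_def by (simp add: algebra_simps eval_nat_numeral)
  then have "\<pi>\<^sup>2 dvd r" using dvd_of_pow3_dvd_square[OF \<pi>(1)] by (metis dvd_triv_left)
  then obtain r0 where r0: "r = \<pi>\<^sup>2 * r0" by (auto elim!: dvdE)
  \<comment> \<open>Solving the equation for \<open>p ^ 3\<close> leaves only terms divisible by
    \<open>\<pi> ^ 4\<close>.\<close>
  have "p ^ 3 = \<pi> ^ 4 * (r0\<^sup>2 + (e1 + S) * p0\<^sup>2 * q'\<^sup>2 - (N + e1 * S) * q' ^ 4 * p0 * \<pi>
          + e1 * N * q' ^ 6 * \<pi>\<^sup>2)"
  proof -
    have "p ^ 3 = hcubic e1 S N p q + (e1 + S) * p\<^sup>2 * q\<^sup>2 - (N + e1 * S) * q ^ 4 * p + e1 * N * q ^ 6"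
      unfolding hcubic_def by (simp add: algebra_simps eval_nat_numeral)
    then show ?thesis
      unfolding r[symmetric] unfolding p0 r0 by (simp add: algebra_simps eval_nat_numeral)
  qed
  then have "\<pi>\<^sup>2 dvd p" using dvd_of_pow4_dvd_cube[OF \<pi>(1)] by (metis dvd_triv_left)
  then obtain p' where p': "p = \<pi>\<^sup>2 * p'" by (auto elim!: dvdE)
  have r6: "r\<^sup>2 = \<pi> ^ 6 * hcubic e1 S N p' q'"
    unfolding r p' p0(2) by (rule hcubic_scale)
  then have "r\<^sup>2 = (\<pi> ^ 3)\<^sup>2 * hcubic e1 S N p' q'" by (simp flip: power_mult)
  then have "(\<pi> ^ 3)\<^sup>2 dvd r\<^sup>2" by (metis dvd_triv_left)
  then have "\<pi> ^ 3 dvd r" by (metis pow_divides_pow_iff zero_less_numeral)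
  then obtain r' where r': "r = \<pi> ^ 3 * r'" by (auto elim!: dvdE)
  have "\<pi> ^ 6 * r'\<^sup>2 = \<pi> ^ 6 * hcubic e1 S N p' q'"
    using r6 unfolding r' by (simp add: power_mult_distrib flip: power_mult)
  then have "r'\<^sup>2 = hcubic e1 S N p' q'" using \<pi>(1) by auto
  then show ?thesis using that p' p0(2) r' by blast
qed

lemma multiplicity_add_less:
  fixes p :: "'a::factorial_ring_gcd"
  assumes "multiplicity p a < multiplicity p b" "a \<noteq> 0" "p \<noteq> 0" "\<not> is_unit p"
  shows "multiplicity p (a + b) = multiplicity p a"
proof -
  define k where "k = multiplicity p a"
  have b: "p ^ Suc k dvd b" using assms(1) by (intro multiplicity_dvd') (simp add: k_def)
  have "\<not> p ^ Suc k dvd a"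
    using assms by (subst power_dvd_iff_le_multiplicity) (auto simp: k_def)
  moreover have "p ^ k dvd a" by (simp add: k_def multiplicity_dvd)
  ultimately have "p ^ k dvd a + b" "\<not> p ^ Suc k dvd a + b"
    using b by (auto simp: dvd_add_left_iff intro: power_le_dvd)
  then show ?thesis unfolding k_def by (rule multiplicity_eqI)
qed

text \<open>If \<open>p\<close> does not divide \<open>d\<close>, then two different multiplicities would make the smaller one
  equal to that of \<open>4 u\<close>, which is even.\<close>

lemma even_multiplicity_factor:
  fixes p :: "'a::factorial_ring_gcd"
  assumes p: "prime p" and two: "(2::'a) \<noteq> 0" and nz: "q \<noteq> 0" "d \<noteq> 0"
    and prod: "M * M' = d * q ^ 4" and sum: "M + M' = 4 * u - 2 * s * q\<^sup>2"
    and cop: "coprime u q" and nd: "\<not> p dvd d"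
  shows "even (multiplicity p M)"
proof -
  define v where "v = multiplicity p"
  define k where "k = v q"
  define m where "m = v 2"
  have pe: "prime_elem p" using p by blast
  have pn: "p \<noteq> 0" "\<not> is_unit p" using p by auto
  have Mnz: "M \<noteq> 0" "M' \<noteq> 0" using prod nz by auto
  have "v d = 0" using nd by (simp add: v_def not_dvd_imp_multiplicity_0)
  have "v (M * M') = v M + v M'"
    unfolding v_def by (rule prime_elem_multiplicity_mult_distrib[OF pe Mnz])
  moreover have "v (d * q ^ 4) = v d + 4 * k"
    unfolding v_def k_def using nz pe
    by (simp add: prime_elem_multiplicity_mult_distrib prime_elem_multiplicity_power_distrib)
  ultimately have vs: "v M + v M' = 4 * k" using prod \<open>v d = 0\<close> by simp
  have dvd: "p ^ n dvd x" if "n \<le> v x" for n x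
    using that unfolding v_def by (rule multiplicity_dvd')
  have ge: "n \<le> v x" if "x \<noteq> 0" "p ^ n dvd x" for n x
    unfolding v_def using that pn by (intro multiplicity_geI) auto
  show ?thesis
  proof (cases "v M = v M'")
    case True
    then have "v M = 2 * k" using vs by simp
    then show ?thesis by (simp add: v_def)
  next
    case False
    define l where "l = min (v M) (v M')"
    \<comment> \<open>Of two different multiplicities with sum \<open>4 * k\<close> the smaller is
      below \<open>2 * k\<close>. In particular \<open>p\<close> divides \<open>q\<close>, hence not
      \<open>u\<close>.\<close>
    have l: "l < 2 * k" using vs False by (auto simp: l_def)
    have kpos: "k > 0" using l by simp
    have pq: "p dvd q" using kpos unfolding k_def v_def
      using not_dvd_imp_multiplicity_0 by fastforce
    then have npu: "\<not> p dvd u" using cop pn by (meson coprime_common_divisor)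
    then have unz: "u \<noteq> 0" by auto
    have "v u = 0" unfolding v_def using npu by (simp add: not_dvd_imp_multiplicity_0)
    \<comment> \<open>The prime may divide 2, but 4 is a square and contributes an even
      amount.\<close>
    have four: "(4::'a) = 2\<^sup>2" by simp
    have v4u: "v (4 * u) = 2 * m"
    proof -
      have "multiplicity p (2\<^sup>2 * u) = 2 * multiplicity p 2"
        using prime_elem_multiplicity_mult_distrib[OF pe _ unz, of "2\<^sup>2"] power_not_zero[OF two, of 2] \<open>v u = 0\<close>
          prime_elem_multiplicity_power_distrib[OF pe two, of 2] unfolding v_def by simp
      then show ?thesis unfolding four v_def m_def .
    qed
    have q2: "p ^ (2 * k) dvd q\<^sup>2"
      using dvd[of k q] by (metis k_def order_refl dvd_power_same power_mult mult.commute)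
    have sq: "p ^ (m + 2 * k) dvd 2 * s * q\<^sup>2"
      using mult_dvd_mono[OF dvd[of m 2] q2] by (simp add: m_def power_add dvd_mult2 ac_simps)
    have vl: "v (M + M') = l"
    proof (cases "v M < v M'")
      case True
      then have "v (M + M') = v M" unfolding v_def using Mnz pn
        by (intro multiplicity_add_less) auto
      then show ?thesis using True by (simp add: l_def)
    next
      case F: False
      then have "v M' < v M" using False by simp
      then have "v (M' + M) = v M'" unfolding v_def using Mnz pn
        by (intro multiplicity_add_less) auto
      then show ?thesis using \<open>v M' < v M\<close> by (simp add: l_def add.commute)
    qed
    have snz: "M + M' \<noteq> 0"
    proof
      assume "M + M' = 0"
      then have "v M' = v M" unfolding v_def
        by (metis add_eq_0_iff multiplicity_uminus_right)
      then show False using False by simp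
    qed
    \<comment> \<open>Otherwise \<open>p ^ (2 * k)\<close> divides both terms of \<open>sum\<close>,
      whereas \<open>M + M'\<close> has multiplicity \<open>l\<close>. The bound makes
      \<open>4 * u\<close> the term of strictly smaller multiplicity.\<close>
    have m2: "m < 2 * k"
    proof (rule ccontr)
      assume "\<not> m < 2 * k"
      then have "2 * k \<le> 2 * m" "2 * k \<le> m + 2 * k" by auto
      then have "p ^ (2 * k) dvd 4 * u" "p ^ (2 * k) dvd 2 * s * q\<^sup>2"
        using dvd[of "2 * k" "4 * u"] v4u power_le_dvd[OF sq, of "2 * k"] by auto
      then have "p ^ (2 * k) dvd M + M'" unfolding sum by (rule dvd_diff)
      then show False using ge[OF snz] vl l by fastforce
    qed
    have "v (M + M') = 2 * m"
    proof (cases "s = 0")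
      case True
      then show ?thesis using sum v4u by simp
    next
      case s: False
      have nz3: "2 * s * q\<^sup>2 \<noteq> 0" using two s nz by simp
      have lt: "v (4 * u) < v (- (2 * s * q\<^sup>2))"
        using ge[OF nz3 sq] v4u m2 by (simp add: v_def)
      have "v (4 * u + - (2 * s * q\<^sup>2)) = v (4 * u)"
        using power_not_zero[OF two, of 2] lt two unz pn unfolding v_def four by (intro multiplicity_add_less) auto
      then show ?thesis using sum v4u by simp
    qed
    then have el: "even l" using vl by simp
    have "even (v M + v M')" using vs by simp
    then have "even (v M)" using el unfolding l_def min_def by (auto split: if_splits)
    then show ?thesis by (simp add: v_def)
  qed
qed

section \<open>Halving points in the kernel of specialization\<close>

text \<open>Here \<open>'a\<close> stands for \<open>R[t]\<close> and \<open>ev\<close> for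
  evaluation at \<open>t0\<close>. \<open>ev_square\<close> combines the hypothesis on
  \<open>t0\<close> with the fact that an element of \<open>R\<close> that is a square in
  \<open>K\<close> is a square in \<open>R\<close>; \<open>ev_unit\<close> reflects that units of
  \<open>R[t]\<close> are constants.\<close>

locale halving_descent =
  fixes ev :: "'a::{factorial_ring_gcd,semiring_gcd_mult_normalize} \<Rightarrow> 'k::field_char_0"
    and e1 S N \<beta> d :: 'a
  assumes ev_1 [simp]: "ev 1 = 1"
    and ev_add [simp]: "ev (x + y) = ev x + ev y"
    and ev_mult [simp]: "ev (x * y) = ev x * ev y"
    and \<beta>_def: "\<beta> = e1\<^sup>2 - S * e1 + N" and d_def: "d = S\<^sup>2 - 4 * N"
    and \<beta>_nz: "\<beta> \<noteq> 0" and d_nz: "d \<noteq> 0"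
    and ev_square: "squarefree D \<Longrightarrow> D dvd \<beta> \<or> D dvd d \<Longrightarrow> ev D = s\<^sup>2 \<Longrightarrow> \<exists>\<delta>. D = \<delta>\<^sup>2"
    and ev_unit: "is_unit u \<Longrightarrow> is_unit v \<Longrightarrow> ev u = ev v \<Longrightarrow> u = v"
    and ev_coprime: "coprime a b \<Longrightarrow> ev a = 0 \<Longrightarrow> ev b \<noteq> 0"
begin

lemma ev_0 [simp]: "ev 0 = 0"
  using ev_add[of 0 0] by simp

lemma ev_minus [simp]: "ev (- x) = - ev x"
  using ev_add[of x "- x"] by (simp add: eq_neg_iff_add_eq_0 add.commute)

lemma ev_diff [simp]: "ev (x - y) = ev x - ev y"
  using ev_add[of x "- y"] by simp

lemma ev_power [simp]: "ev (x ^ n) = ev x ^ n"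
  by (induction n) simp_all

lemma ev_of_nat [simp]: "ev (of_nat n) = of_nat n"
  by (induction n) simp_all

lemma ev_numeral [simp]: "ev (numeral n) = numeral n"
  using ev_of_nat[of "numeral n"] by simp

lemma two_nz: "(2 :: 'a) \<noteq> 0"
proof
  assume "(2 :: 'a) = 0"
  then have "ev 2 = ev 0" by simp
  then show False by simp
qed

text \<open>In \<open>a = D * w\<^sup>2\<close> with square-free part \<open>D\<close>, the value
  \<open>ev D\<close> is the square of \<open>s / ev w\<close>, so \<open>ev_square\<close> makes
  \<open>D\<close> a square.\<close>

lemma square_of_ev_square:
  assumes "squarefree_part a dvd \<beta> \<or> squarefree_part a dvd d"
    and "ev a = s\<^sup>2" "ev a \<noteq> 0"
  obtains w where "a = w\<^sup>2"
proof -
  define D where "D = squarefree_part a"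
  define w where "w = square_part a"
  have a: "a = D * w\<^sup>2" unfolding D_def w_def by (rule squarefree_decompose)
  have w: "ev w \<noteq> 0" using assms(3) by (auto simp: a)
  have "ev D = (s / ev w)\<^sup>2" using assms(2) w by (simp add: a power_divide field_simps)
  then obtain \<delta> where "D = \<delta>\<^sup>2" using ev_square[of D] assms(1) unfolding D_def by blast
  then have "a = (\<delta> * w)\<^sup>2" by (simp add: a power_mult_distrib)
  then show ?thesis using that by blast
qed

text \<open>The quadratic factor \<open>G\<close> is congruent to \<open>\<beta> * q ^ 4\<close>
  modulo the linear factor \<open>X\<close>. By coprimality a prime dividing \<open>X\<close> but
  not \<open>\<beta>\<close> does not divide \<open>G\<close>, so its multiplicity in
  \<open>X\<close> is that in \<open>r\<^sup>2\<close>.\<close>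

lemma squarefree_part_dvd_\<beta>:
  assumes cop: "coprime p q" and r: "r\<^sup>2 = hcubic e1 S N p q" and nz: "p - e1 * q\<^sup>2 \<noteq> 0"
    and q: "q \<noteq> 0"
  shows "squarefree_part (p - e1 * q\<^sup>2) dvd \<beta>"
proof (rule squarefree_part_dvd[OF \<beta>_nz])
  fix \<pi> :: 'a
  assume \<pi>: "prime \<pi>" and nd: "\<not> \<pi> dvd \<beta>"
  define X where "X = p - e1 * q\<^sup>2"
  define G where "G = p\<^sup>2 - S * p * q\<^sup>2 + N * q ^ 4"
  have G: "G = X * (X + (2 * e1 - S) * q\<^sup>2) + \<beta> * q ^ 4"
    unfolding G_def X_def \<beta>_def by (simp add: algebra_simps eval_nat_numeral)
  have rXG: "r\<^sup>2 = X * G" unfolding r hcubic_def X_def G_def ..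
  show "even (multiplicity \<pi> (p - e1 * q\<^sup>2))"
  proof (cases "\<pi> dvd X")
    case False
    then show ?thesis by (simp add: not_dvd_imp_multiplicity_0 X_def)
  next
    case True
    have "\<not> \<pi> dvd G"
    proof
      assume "\<pi> dvd G"
      then have "\<pi> dvd \<beta> * q ^ 4" using True unfolding G
        by (metis dvd_add_right_iff dvd_mult2)
      then have "\<pi> dvd q" using nd \<pi> by (metis prime_dvd_mult_iff prime_dvd_power)
      moreover have "p = X + e1 * q * q" by (simp add: X_def power2_eq_square)
      ultimately have "\<pi> dvd p" using True by simp
      then show False using \<open>\<pi> dvd q\<close> cop \<pi> by (meson coprime_common_divisor not_prime_unit)
    qed
    moreover from this have "G \<noteq> 0" by auto
    moreover have "X \<noteq> 0" using nz by (simp add: X_def)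
    ultimately have "multiplicity \<pi> (r\<^sup>2) = multiplicity \<pi> X"
      using \<pi> unfolding rXG
      by (simp add: prime_elem_multiplicity_mult_distrib not_dvd_imp_multiplicity_0)
    moreover have "r \<noteq> 0" using rXG \<open>X \<noteq> 0\<close> \<open>G \<noteq> 0\<close> by auto
    ultimately have "multiplicity \<pi> X = 2 * multiplicity \<pi> r" using \<pi>
      by (simp add: prime_elem_multiplicity_power_distrib)
    then show ?thesis by (simp add: X_def)
  qed
qed

text \<open>With \<open>x(P) = p / q\<^sup>2\<close>, the point \<open>Q\<close> with \<open>2 Q = P\<close> has
  \<open>x(Q) = x(P) + r\<^sub>1 r\<^sub>2 + r\<^sub>1 r\<^sub>3 + r\<^sub>2 r\<^sub>3\<close>, where \<open>r\<^sub>i\<close> are square roots of the differences of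
  \<open>x(P)\<close> and the roots of the cubic. Here \<open>r\<^sub>1 = w / q\<close>, \<open>r\<^sub>2 + r\<^sub>3 = m / q\<close> and
  \<open>r\<^sub>2 r\<^sub>3 = n / q\<^sup>2\<close>; the signs are chosen so that \<open>Q\<close> again specializes to the neutral element.\<close>

lemma halving:
  assumes q: "q \<noteq> 0" "ev q = 0" and cop: "coprime p q" and r: "r\<^sup>2 = hcubic e1 S N p q"
  obtains p' m where "(p' - e1 * q\<^sup>2) dvd \<beta> * q ^ 4" "m\<^sup>2 dvd d * q ^ 4"
    "m\<^sup>2 * (p' - e1 * q\<^sup>2) =
       (p' - e1 * q\<^sup>2)\<^sup>2 + (2 * e1 - S) * (p' - e1 * q\<^sup>2) * q\<^sup>2 + \<beta> * q ^ 4"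
    "((p' - e1 * q\<^sup>2) * m)\<^sup>2 = hcubic e1 S N p' q"
    "ev p' = 4 * ev p"
proof -
  have p0: "ev p \<noteq> 0" using ev_coprime[of q p] cop q by (simp add: coprime_commute)
  have "(ev r)\<^sup>2 = ev (r\<^sup>2)" by simp
  also have "\<dots> = ev p ^ 3" unfolding r hcubic_def using q by (simp add: eval_nat_numeral)
  finally have "ev p = (ev r / ev p)\<^sup>2" using p0 by (simp add: power_divide eval_nat_numeral)
  then obtain c where c: "ev p = c\<^sup>2" by blast
  have X0: "ev (p - e1 * q\<^sup>2) = ev p" using q by simp
  then have Xnz: "p - e1 * q\<^sup>2 \<noteq> 0" using p0 by force
  obtain w where w: "p - e1 * q\<^sup>2 = w\<^sup>2"
    using square_of_ev_square[of "p - e1 * q\<^sup>2" c] squarefree_part_dvd_\<beta>[OF cop r Xnz q(1)] X0 c p0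
    by metis
  have wnz: "w \<noteq> 0" using Xnz w by auto
  define G where "G = p\<^sup>2 - S * p * q\<^sup>2 + N * q ^ 4"
  have rG: "r\<^sup>2 = w\<^sup>2 * G" unfolding r hcubic_def G_def w ..
  then have "w dvd r" by (metis dvd_triv_left pow_divides_pow_iff zero_less_numeral)
  then obtain n0 where "r = w * n0" by (auto elim!: dvdE)
  then have n0: "n0\<^sup>2 = G" using rG wnz by (simp add: power_mult_distrib)
  have "(ev n0)\<^sup>2 = (ev p)\<^sup>2"
    using arg_cong[OF n0, of ev] q by (simp add: G_def)
  \<comment> \<open>The other sign would give \<open>ev M = 0\<close> below, and the value would no
    longer show that \<open>M\<close> is a square.\<close>
  then have "ev n0 = ev p \<or> ev (- n0) = ev p" by (auto simp: power2_eq_iff)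
  then obtain n where n: "n\<^sup>2 = G" "ev n = ev p" using n0 by (metis power2_minus)
  \<comment> \<open>These are \<open>q\<^sup>2\<close> times the squares of
    \<open>r\<^sub>2 + r\<^sub>3\<close> and \<open>r\<^sub>2 - r\<^sub>3\<close>, which explains
    the product \<open>d * q ^ 4\<close>.\<close>
  define M where "M = 2 * p - S * q\<^sup>2 + 2 * n"
  define M' where "M' = 2 * p - S * q\<^sup>2 - 2 * n"
  have MM: "M * M' = d * q ^ 4"
  proof -
    have "M * M' = (2 * p - S * q\<^sup>2)\<^sup>2 - 4 * n\<^sup>2"
      unfolding M_def M'_def by (simp add: algebra_simps eval_nat_numeral)
    then show ?thesis unfolding n G_def d_def by (simp add: algebra_simps eval_nat_numeral)
  qed
  have "M + M' = 4 * p - 2 * S * q\<^sup>2" unfolding M_def M'_def by (simp add: algebra_simps)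
  then have "squarefree_part M dvd d"
    using even_multiplicity_factor[OF _ two_nz q(1) d_nz MM _ cop]
    by (intro squarefree_part_dvd[OF d_nz]) blast
  moreover have M0: "ev M = 4 * ev p" using q n by (simp add: M_def)
  then have "ev M = (2 * c)\<^sup>2" by (simp add: c)
  ultimately obtain m0 where m0: "M = m0\<^sup>2" using square_of_ev_square[of M "2 * c"] p0 M0
    by (metis mult_eq_0_iff zero_neq_numeral)
  \<comment> \<open>The sign with \<open>ev m = 2 * ev w\<close> gives
    \<open>ev \<rho> = 4 * ev p\<close> below; the other one gives 0.\<close>
  have "(ev m0)\<^sup>2 = (2 * ev w)\<^sup>2"
    using arg_cong[OF m0, of ev] arg_cong[OF w, of ev] M0 q by simp
  then have "ev m0 = 2 * ev w \<or> ev (- m0) = 2 * ev w" unfolding power2_eq_iff by auto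
  then obtain m where m: "M = m\<^sup>2" "ev m = 2 * ev w" using m0 by (metis power2_minus)
  \<comment> \<open>\<open>\<rho> / q\<^sup>2\<close> is
    \<open>(r\<^sub>1 + r\<^sub>2) * (r\<^sub>1 + r\<^sub>3)\<close>, the difference of
    \<open>x(Q)\<close> and \<open>e1\<close>.\<close>
  define \<rho> where "\<rho> = w\<^sup>2 + w * m + n"
  define p' where "p' = \<rho> + e1 * q\<^sup>2"
  have \<rho>: "p' - e1 * q\<^sup>2 = \<rho>" by (simp add: p'_def)
  have p: "p = w\<^sup>2 + e1 * q\<^sup>2" using w by (simp add: algebra_simps)
  have m2: "m\<^sup>2 = 2 * w\<^sup>2 + (2 * e1 - S) * q\<^sup>2 + 2 * n"
    unfolding m(1)[symmetric] M_def p by (simp add: algebra_simps)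
  have n2: "n\<^sup>2 = w ^ 4 + (2 * e1 - S) * w\<^sup>2 * q\<^sup>2 + \<beta> * q ^ 4"
    unfolding n G_def p \<beta>_def by (simp add: algebra_simps eval_nat_numeral)
  \<comment> \<open>The second factor is \<open>\<rho>\<close> with \<open>m\<close> replaced by
    \<open>- m\<close>; only \<open>m\<^sup>2\<close> remains in the product.\<close>
  have "\<rho> * (w\<^sup>2 + n - w * m) = (w\<^sup>2 + n)\<^sup>2 - w\<^sup>2 * m\<^sup>2"
    unfolding \<rho>_def by (simp add: algebra_simps eval_nat_numeral)
  also have "\<dots> = n\<^sup>2 - w ^ 4 - (2 * e1 - S) * w\<^sup>2 * q\<^sup>2"
    unfolding m2 by (simp add: algebra_simps eval_nat_numeral)
  also have "\<dots> = \<beta> * q ^ 4" unfolding n2 by simp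
  finally have \<rho>\<beta>: "\<rho> * (w\<^sup>2 + n - w * m) = \<beta> * q ^ 4" .
  \<comment> \<open>The right-hand side is the quadratic factor of the form at \<open>p'\<close>,
    expanded around \<open>e1\<close>; hence the form is the square of
    \<open>\<rho> * m\<close>.\<close>
  have 1: "m\<^sup>2 * \<rho> = \<rho>\<^sup>2 + (2 * e1 - S) * \<rho> * q\<^sup>2 + \<beta> * q ^ 4"
  proof -
    have "m\<^sup>2 * \<rho> = \<rho> * (2 * w\<^sup>2 + 2 * n) + (2 * e1 - S) * \<rho> * q\<^sup>2"
      unfolding m2 by (simp add: algebra_simps)
    also have "\<rho> * (2 * w\<^sup>2 + 2 * n) = \<rho>\<^sup>2 + \<rho> * (w\<^sup>2 + n - w * m)"
      by (simp add: \<rho>_def algebra_simps eval_nat_numeral)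
    finally show ?thesis unfolding \<rho>\<beta> by simp
  qed
  have "(\<rho> * m)\<^sup>2 = \<rho> * (m\<^sup>2 * \<rho>)" by (simp add: algebra_simps eval_nat_numeral)
  also have "\<dots> = hcubic e1 S N p' q"
    unfolding 1 hcubic_def p'_def \<beta>_def by (simp add: algebra_simps eval_nat_numeral)
  finally have 2: "(\<rho> * m)\<^sup>2 = hcubic e1 S N p' q" .
  have "ev w ^ 2 = ev p" using arg_cong[OF w, of ev] q by simp
  then have 3: "ev p' = 4 * ev p" using q n m
    by (simp add: p'_def \<rho>_def power2_eq_square)
  show ?thesis
    using that[of p' m] 1 2 3 \<rho>\<beta> MM m(1) unfolding \<rho> by (metis dvd_triv_left)
qed

text \<open>Scaling \<open>\<mu>\<close> and \<open>\<rho>\<close> by \<open>t\<close> gives an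
  equation of degree at most 2 in \<open>t\<close> with the roots 1, \<open>u\<close> and
  \<open>v\<close>, so its constant term vanishes. It will be applied to three halvings that differ
  by units.\<close>

lemma eq_zero_of_three_multiples:
  fixes q \<rho> \<mu> :: 'a
  assumes eq: "\<mu> * \<rho> = \<rho>\<^sup>2 + a * \<rho> * q\<^sup>2 + b"
    "(u * \<mu>) * (u * \<rho>) = (u * \<rho>)\<^sup>2 + a * (u * \<rho>) * q\<^sup>2 + b"
    "(v * \<mu>) * (v * \<rho>) = (v * \<rho>)\<^sup>2 + a * (v * \<rho>) * q\<^sup>2 + b"
    and ne: "u \<noteq> 1" "v \<noteq> 1" "u \<noteq> v"
  shows "b = 0"
proof -
  have *: "t * a * \<rho> * q\<^sup>2 + (t + 1) * b = 0"
    if t: "(t * \<mu>) * (t * \<rho>) = (t * \<rho>)\<^sup>2 + a * (t * \<rho>) * q\<^sup>2 + b" "t \<noteq> 1" for t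
  proof -
    have "(t * \<mu>) * (t * \<rho>) = t\<^sup>2 * (\<mu> * \<rho>)" by (simp add: algebra_simps eval_nat_numeral)
    then have "(t * \<rho>)\<^sup>2 + a * (t * \<rho>) * q\<^sup>2 + b = t\<^sup>2 * (\<rho>\<^sup>2 + a * \<rho> * q\<^sup>2 + b)"
      using t eq(1) by simp
    then have "(t - 1) * (t * a * \<rho> * q\<^sup>2 + (t + 1) * b) = 0"
      by (simp add: algebra_simps eval_nat_numeral)
    then show ?thesis using t(2) by simp
  qed
  have "v * (u * a * \<rho> * q\<^sup>2 + (u + 1) * b) - u * (v * a * \<rho> * q\<^sup>2 + (v + 1) * b) = (v - u) * b"
    by (simp add: algebra_simps)
  then show ?thesis using *[OF eq(2) ne(1)] *[OF eq(3) ne(2)] ne(3) by simp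
qed

end

text \<open>Applied to prime factorizations: a nonzero element has only finitely many divisors up to
  units.\<close>

lemma finite_subset_mset: "finite {B :: 'a multiset. B \<subseteq># A}"
proof (induction A)
  case (add x A)
  have "{B. B \<subseteq># add_mset x A} \<subseteq> {B. B \<subseteq># A} \<union> add_mset x ` {B. B \<subseteq># A}"
  proof
    fix B
    assume B: "B \<in> {B. B \<subseteq># add_mset x A}"
    show "B \<in> {B. B \<subseteq># A} \<union> add_mset x ` {B. B \<subseteq># A}"
    proof (cases "x \<in># B")
      case True
      then obtain B' where "B = add_mset x B'" by (metis multi_member_split)
      then show ?thesis using B by auto
    next
      case False
      have "count B y \<le> count A y" for y
      proof -
        have "count B y \<le> count (add_mset x A) y" using B by (intro mset_subset_eq_count) simp
        then show ?thesis using False by (cases "y = x") (auto simp: not_in_iff)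
      qed
      then have "B \<subseteq># A" by (simp add: subseteq_mset_def)
      then show ?thesis by simp
    qed
  qed
  then show ?case using add finite_subset by blast
qed simp

section \<open>Infinitely many halvings against finitely many divisors\<close>

context halving_descent
begin

text \<open>Repeated halving never leaves the solutions with denominator \<open>q\<close>. Up to units the
  polynomials \<open>p - e1 q\<^sup>2\<close> and \<open>m\<^sup>2\<close> then take only finitely many values, since they divide \<open>\<beta>\<close>
  and \<open>d\<close>, whereas \<open>ev p\<close> is multiplied by \<open>4\<close> in each step.\<close>

lemma no_solution_of_coprime:
  assumes q: "q \<noteq> 0" "ev q = 0"
    and cop: "\<And>p r. r\<^sup>2 = hcubic e1 S N p q \<Longrightarrow> ev p \<noteq> 0 \<Longrightarrow> coprime p q"
    and r: "r\<^sup>2 = hcubic e1 S N p q" and p: "ev p \<noteq> 0"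
  shows False
proof -
  \<comment> \<open>\<open>P 0\<close> already describes a half, since \<open>m\<close> arises from
    a halving; hence the extra factor 4.\<close>
  define P where "P i = (\<lambda>(p', m). ev p' = 4 ^ i * (4 * ev p) \<and>
    ((p' - e1 * q\<^sup>2) * m)\<^sup>2 = hcubic e1 S N p' q \<and>
    (p' - e1 * q\<^sup>2) dvd \<beta> * q ^ 4 \<and> m\<^sup>2 dvd d * q ^ 4 \<and>
    m\<^sup>2 * (p' - e1 * q\<^sup>2) =
       (p' - e1 * q\<^sup>2)\<^sup>2 + (2 * e1 - S) * (p' - e1 * q\<^sup>2) * q\<^sup>2 + \<beta> * q ^ 4)" for i :: nat
  have "\<exists>z. P i z" for i
  proof (induction i)
    case 0
    obtain p' m where "(p' - e1 * q\<^sup>2) dvd \<beta> * q ^ 4" "m\<^sup>2 dvd d * q ^ 4"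
      "m\<^sup>2 * (p' - e1 * q\<^sup>2) =
         (p' - e1 * q\<^sup>2)\<^sup>2 + (2 * e1 - S) * (p' - e1 * q\<^sup>2) * q\<^sup>2 + \<beta> * q ^ 4"
      "((p' - e1 * q\<^sup>2) * m)\<^sup>2 = hcubic e1 S N p' q" "ev p' = 4 * ev p"
      using halving[OF q cop[OF r p] r] .
    then have "P 0 (p', m)" by (simp add: P_def)
    then show ?case by blast
  next
    case (Suc i)
    then obtain p1 m1 where 1: "ev p1 = 4 ^ i * (4 * ev p)"
        "((p1 - e1 * q\<^sup>2) * m1)\<^sup>2 = hcubic e1 S N p1 q"
      by (auto simp: P_def)
    have nz: "ev p1 \<noteq> 0" using 1 p by simp
    obtain p' m where "(p' - e1 * q\<^sup>2) dvd \<beta> * q ^ 4" "m\<^sup>2 dvd d * q ^ 4"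
      "m\<^sup>2 * (p' - e1 * q\<^sup>2) =
         (p' - e1 * q\<^sup>2)\<^sup>2 + (2 * e1 - S) * (p' - e1 * q\<^sup>2) * q\<^sup>2 + \<beta> * q ^ 4"
      "((p' - e1 * q\<^sup>2) * m)\<^sup>2 = hcubic e1 S N p' q" "ev p' = 4 * ev p1"
      using halving[OF q cop[OF 1(2) nz] 1(2)] .
    then have "P (Suc i) (p', m)" using 1(1) by (simp add: P_def)
    then show ?case by blast
  qed
  then obtain z where z: "P i (z i)" for i by metis
  define \<rho> where "\<rho> i = fst (z i) - e1 * q\<^sup>2" for i
  define \<mu> where "\<mu> i = (snd (z i))\<^sup>2" for i
  have hc: "(\<rho> i * snd (z i))\<^sup>2 = hcubic e1 S N (fst (z i)) q"
    and div: "\<rho> i dvd \<beta> * q ^ 4" "\<mu> i dvd d * q ^ 4"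
    and eq: "\<mu> i * \<rho> i = (\<rho> i)\<^sup>2 + (2 * e1 - S) * \<rho> i * q\<^sup>2 + \<beta> * q ^ 4"
    and ev_fst: "ev (fst (z i)) = 4 ^ i * (4 * ev p)" for i
    using z[of i] by (auto simp: P_def \<rho>_def \<mu>_def)
  have ev_\<rho>: "ev (\<rho> i) = 4 ^ i * (4 * ev p)" for i using ev_fst q by (simp add: \<rho>_def)
  have \<rho>nz: "ev (\<rho> i) \<noteq> 0" for i using ev_\<rho> p by simp
  \<comment> \<open>Where \<open>q\<close> vanishes, \<open>eq\<close> becomes
    \<open>ev (\<mu> i) * ev (\<rho> i) = (ev (\<rho> i))\<^sup>2\<close>. This later forces the
    units for \<open>\<rho>\<close> and for \<open>\<mu>\<close> to agree.\<close>
  have ev_\<mu>: "ev (\<mu> i) = ev (\<rho> i)" for i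
    using arg_cong[OF eq[of i], of ev] q \<rho>nz[of i] by (simp add: power2_eq_square)
  have "coprime (fst (z i)) q" for i
    using cop[OF hc[of i]] ev_fst[of i] p by simp
  \<comment> \<open>Both divide the form, which is coprime to \<open>q\<close>, so
    \<open>q ^ 4\<close> drops out of the divisibilities.\<close>
  from coprime_hcubic[OF this, of e1 S N]
  have "coprime (\<rho> i) q" "coprime (\<mu> i) q" for i
    unfolding hc[symmetric] \<mu>_def by auto
  then have dvd: "\<rho> i dvd \<beta>" "\<mu> i dvd d" for i
    using div[of i] by (auto simp: coprime_dvd_mult_left_iff)
  define f where "f i = (prime_factorization (\<rho> i), prime_factorization (\<mu> i))" for i
  have nz: "\<rho> i \<noteq> 0" "\<mu> i \<noteq> 0" for i
    using \<rho>nz[of i] ev_\<mu>[of i] by force+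
  have "range f \<subseteq> {B. B \<subseteq># prime_factorization \<beta>} \<times> {B. B \<subseteq># prime_factorization d}"
    using dvd nz \<beta>_nz d_nz by (auto simp: f_def prime_factorization_subset_iff_dvd)
  then have "finite (range f)"
    by (rule finite_subset) (intro finite_cartesian_product finite_subset_mset)
  then obtain i0 where "infinite {i. f i = f i0}"
    using pigeonhole_infinite[of "UNIV :: nat set" f] by auto
  \<comment> \<open>Three indices, because the relation is quadratic in the unit.\<close>
  then obtain I where "card I = 3" "I \<subseteq> {i. f i = f i0}"
    using infinite_arbitrarily_large by blast
  then obtain i j k where ijk: "f i = f i0" "f j = f i0" "f k = f i0" "i \<noteq> j" "j \<noteq> k" "i \<noteq> k"
    by (auto simp: card_3_iff)
  have unit: "\<exists>u. \<rho> l = u * \<rho> i \<and> \<mu> l = u * \<mu> i \<and> 4 ^ l = ev u * 4 ^ i" if "f l = f i" for l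
  proof -
    have "normalize (\<rho> l) = normalize (\<rho> i)" "normalize (\<mu> l) = normalize (\<mu> i)"
      using that nz by (simp_all add: f_def prime_factorization_unique)
    then obtain u v where uv: "is_unit u" "is_unit v" "\<rho> l = u * \<rho> i" "\<mu> l = v * \<mu> i"
      by (metis nz associatedE2)
    have u: "ev u * 4 ^ i = 4 ^ l"
      using arg_cong[OF uv(3), of ev] p by (simp add: ev_\<rho>)
    have v: "ev v * 4 ^ i = 4 ^ l"
      using arg_cong[OF uv(4), of ev] p by (simp add: ev_\<rho> ev_\<mu>)
    have "ev u = ev v" using u v by (metis mult_right_cancel power_not_zero zero_neq_numeral)
    then have "u = v" using uv ev_unit by blast
    then show ?thesis using uv u by auto
  qed
  obtain u where u: "\<rho> j = u * \<rho> i" "\<mu> j = u * \<mu> i" "ev u * 4 ^ i = 4 ^ j"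
    using unit[of j] ijk by metis
  obtain v where v: "\<rho> k = v * \<rho> i" "\<mu> k = v * \<mu> i" "ev v * 4 ^ i = 4 ^ k"
    using unit[of k] ijk by metis
  have pow4: "a = b" if "(4 :: 'k) ^ a = 4 ^ b" for a b
  proof -
    have "of_nat (4 ^ a) = (of_nat (4 ^ b) :: 'k)" using that by simp
    then have "(4 :: nat) ^ a = 4 ^ b" by (simp only: of_nat_eq_iff)
    then show ?thesis by simp
  qed
  have "u \<noteq> 1" "v \<noteq> 1" "u \<noteq> v" using u(3) v(3) pow4[of i j] pow4[of i k] pow4[of j k] ijk by auto
  then have "\<beta> * q ^ 4 = 0"
    using eq_zero_of_three_multiples[of "\<mu> i" "\<rho> i" "2 * e1 - S" q "\<beta> * q ^ 4" u v]
      eq[of i] eq[of j] eq[of k] unfolding u v by blast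
  then show False using \<beta>_nz q by simp
qed

text \<open>As 0 is a square, a prime factor with value 0 would be a square by
  \<open>ev_square\<close>. Applied to \<open>\<beta>\<close> and \<open>d\<close>, this makes the
  specialized discriminant nonzero.\<close>

lemma ev_nonzero:
  assumes "a \<noteq> 0" "\<And>D. D dvd a \<Longrightarrow> D dvd \<beta> \<or> D dvd d"
  shows "ev a \<noteq> 0"
proof -
  have unit: "ev u \<noteq> 0" if u: "is_unit u" for u
  proof
    assume "ev u = 0"
    moreover obtain v where "1 = u * v" using u by (auto elim!: dvdE)
    then have "ev u * ev v = 1" using ev_mult[of u v] by simp
    ultimately show False by simp
  qed
  have prime: "ev \<pi> \<noteq> 0" if \<pi>: "prime \<pi>" "\<pi> dvd a" for \<pi>
  proof
    assume "ev \<pi> = 0"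
    then obtain \<delta> where \<delta>: "\<pi> = \<delta>\<^sup>2"
      using ev_square[of \<pi> 0] assms(2)[OF \<pi>(2)] squarefree_prime[OF \<pi>(1)] by auto
    then have "is_unit \<delta>"
      using squarefreeD[OF squarefree_prime[OF \<pi>(1)], of \<delta>] by simp
    then have "is_unit \<pi>" unfolding \<delta> by (simp add: is_unit_power_iff)
    then show False using \<pi>(1) by auto
  qed
  have "x dvd a \<Longrightarrow> ev x \<noteq> 0" for x
  proof (induction x rule: prime_divisors_induct)
    case zero
    then show ?case using assms(1) by simp
  next
    case (factor p x)
    then show ?case using prime[of p] by (auto dest: dvd_mult_left dvd_mult_right)
  qed (rule unit)
  then show ?thesis by simp
qed

text \<open>In a counterexample whose \<open>q\<close> has the fewest prime factors,
  \<open>hcubic_reduce\<close> would shorten \<open>q\<close>. Thus every counterexample with this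
  \<open>q\<close> is in lowest terms, as \<open>no_solution_of_coprime\<close> requires.\<close>

lemma no_nonregular_solution:
  assumes q: "q \<noteq> 0" and r: "r\<^sup>2 = hcubic e1 S N p q"
  obtains a b where "ev b \<noteq> 0" "p * b = a * q\<^sup>2"
proof (rule ccontr)
  \<comment> \<open>\<open>NR\<close> says without fractions that \<open>p / q\<^sup>2\<close> has a
    pole.\<close>
  define NR where "NR = (\<lambda>(p, q, r). q \<noteq> 0 \<and> r\<^sup>2 = hcubic e1 S N p q \<and>
    (\<forall>a b. ev b \<noteq> 0 \<longrightarrow> p * b \<noteq> a * q\<^sup>2))"
  define sz where "sz = (\<lambda>(p :: 'a, q :: 'a, r :: 'a). size (prime_factorization q))"
  assume "\<not> thesis"
  then have "NR (p, q, r)" using that q r by (auto simp: NR_def)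
  then obtain z where z: "NR z" "\<And>y. NR y \<Longrightarrow> sz z \<le> sz y"
    using ex_has_least_nat[of NR _ sz] by metis
  obtain p0 q0 r0 where z_eq: "z = (p0, q0, r0)" by (cases z)
  have q0: "q0 \<noteq> 0" and r0: "r0\<^sup>2 = hcubic e1 S N p0 q0"
    and nr: "\<And>a b. ev b \<noteq> 0 \<Longrightarrow> p0 * b \<noteq> a * q0\<^sup>2"
    using z(1) by (auto simp: NR_def z_eq)
  have cop: "coprime p1 q0" if NR1: "NR (p1, q0, r1)" for p1 r1
  proof (rule ccontr)
    assume "\<not> coprime p1 q0"
    then have "\<not> is_unit (gcd p1 q0)" by (metis coprime_iff_gcd_eq_1 is_unit_gcd_iff)
    moreover have "gcd p1 q0 \<noteq> 0" using q0 by simp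
    ultimately obtain \<pi> where \<pi>: "prime \<pi>" "\<pi> dvd p1" "\<pi> dvd q0"
      using prime_divisor_exists[of "gcd p1 q0"] by auto
    have r1: "r1\<^sup>2 = hcubic e1 S N p1 q0" using NR1 by (simp add: NR_def)
    obtain p' q' r' where red: "p1 = \<pi>\<^sup>2 * p'" "q0 = \<pi> * q'"
        "r'\<^sup>2 = hcubic e1 S N p' q'"
      using hcubic_reduce[OF \<pi> r1] by metis
    have "p' * b \<noteq> a * q'\<^sup>2" if b: "ev b \<noteq> 0" for a b
    proof
      assume "p' * b = a * q'\<^sup>2"
      then have "p1 * b = a * q0\<^sup>2" by (simp add: red power_mult_distrib mult.left_commute mult.assoc)
      then show False using NR1 b by (auto simp: NR_def)
    qed
    then have "NR (p', q', r')" using red q0 by (auto simp: NR_def)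
    then have "sz z \<le> sz (p', q', r')" by (rule z(2))
    moreover have "prime_factorization q0 = add_mset \<pi> (prime_factorization q')"
      using red(2) q0 \<pi>(1) by (simp add: prime_factorization_mult prime_factorization_prime)
    ultimately show False by (simp add: sz_def z_eq)
  qed
  \<comment> \<open>Otherwise \<open>q0\<^sup>2\<close> would itself be an admissible
    denominator.\<close>
  have ev_q0: "ev q0 = 0" using nr[of "q0\<^sup>2" p0] by auto
  have ev_p0: "ev p0 \<noteq> 0"
    using ev_coprime[of q0 p0] cop[of p0 r0] z(1) ev_q0 by (simp add: z_eq coprime_commute)
  show False
  proof (rule no_solution_of_coprime[OF q0 ev_q0 _ r0 ev_p0])
    fix p r
    assume pr: "r\<^sup>2 = hcubic e1 S N p q0" "ev p \<noteq> 0"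
    have "p * b \<noteq> a * q0\<^sup>2" if "ev b \<noteq> 0" for a b
    proof
      assume "p * b = a * q0\<^sup>2"
      then have "ev (p * b) = ev (a * q0\<^sup>2)" by (rule arg_cong)
      then show False using pr(2) that ev_q0 by simp
    qed
    then show "coprime p q0" using pr q0 by (intro cop) (auto simp: NR_def)
  qed
qed

end

section \<open>Chord and tangent law on \<open>y\<^sup>2 = x\<^sup>3 + a x\<^sup>2 + b x + c\<close>\<close>

lemma cubic_curve_sel [simp]:
  "wa1 (cubic_curve a b c) = 0" "wa2 (cubic_curve a b c) = a" "wa3 (cubic_curve a b c) = 0"
  "wa4 (cubic_curve a b c) = b" "wa6 (cubic_curve a b c) = c"
  by (simp_all add: cubic_curve_def)

definition on_cubic :: "'a::field \<Rightarrow> 'a \<Rightarrow> 'a \<Rightarrow> 'a \<Rightarrow> 'a \<Rightarrow> bool" where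
  "on_cubic a b c x y \<longleftrightarrow> y\<^sup>2 = x ^ 3 + a * x\<^sup>2 + b * x + c"

lemma ec_points_cubic:
  "ec_points (cubic_curve a b c) = insert Neutral {Point x y | x y. on_cubic a b c x y}"
  by (simp add: ec_points_def on_cubic_def)

lemma on_cubic_minus [simp]: "on_cubic a b c x (- y) \<longleftrightarrow> on_cubic a b c x y"
  by (simp add: on_cubic_def)

lemma ec_add_opposite: "ec_add (cubic_curve a b c) (Point x y) (Point x (- y)) = Neutral"
  by simp

lemma ec_add_distinct:
  assumes "x1 \<noteq> x2" "l = (y2 - y1) / (x2 - x1)"
  shows "ec_add (cubic_curve a b c) (Point x1 y1) (Point x2 y2) =
    Point (l\<^sup>2 - a - x1 - x2) (- l * (l\<^sup>2 - a - x1 - x2) - (y1 - l * x1))"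
  using assms by (simp add: Let_def)

lemma ec_add_same:
  assumes "y + y \<noteq> 0" "l = (3 * x\<^sup>2 + 2 * a * x + b) / (2 * y)"
  shows "ec_add (cubic_curve a b c) (Point x y) (Point x y) =
    Point (l\<^sup>2 - a - x - x) (- l * (l\<^sup>2 - a - x - x) - (y - l * x))"
  using assms by (simp add: Let_def)

text \<open>Dividing by \<open>x2 - x1\<close> turns the chord slope into an expression that is
  still meaningful for equal abscissas, where it is the tangent slope.\<close>

lemma on_cubic_diff:
  assumes "on_cubic a b c x1 y1" "on_cubic a b c x2 y2"
  shows "(y2 - y1) * (y1 + y2) = (x2 - x1) * (x1\<^sup>2 + x1 * x2 + x2\<^sup>2 + a * (x1 + x2) + b)"
proof -
  have "(y2 - y1) * (y1 + y2) = y2\<^sup>2 - y1\<^sup>2" by (simp add: algebra_simps eval_nat_numeral)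
  then show ?thesis
    using assms by (simp add: on_cubic_def algebra_simps eval_nat_numeral)
qed

text \<open>Chord and tangent are treated uniformly: both relations hold for the slope \<open>l\<close> in
  either case.\<close>

lemma ec_add_slope:
  fixes a b c :: "'a::field"
  assumes P: "on_cubic a b c x1 y1" and Q: "on_cubic a b c x2 y2"
    and ne: "\<not> (x1 = x2 \<and> y1 + y2 = 0)"
  obtains l where "l * (x2 - x1) = y2 - y1"
    "l * (y1 + y2) = x1\<^sup>2 + x1 * x2 + x2\<^sup>2 + a * (x1 + x2) + b"
    "ec_add (cubic_curve a b c) (Point x1 y1) (Point x2 y2) =
       Point (l\<^sup>2 - a - x1 - x2) (- l * (l\<^sup>2 - a - x1 - x2) - (y1 - l * x1))"
proof (cases "x1 = x2")
  case False
  define l where "l = (y2 - y1) / (x2 - x1)"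
  have 1: "l * (x2 - x1) = y2 - y1" using False by (simp add: l_def)
  have "(x2 - x1) * (l * (y1 + y2)) = (y2 - y1) * (y1 + y2)"
    unfolding 1[symmetric] by (simp add: algebra_simps)
  then have "l * (y1 + y2) = x1\<^sup>2 + x1 * x2 + x2\<^sup>2 + a * (x1 + x2) + b"
    unfolding on_cubic_diff[OF P Q] using False by simp
  then show ?thesis using that 1 ec_add_distinct[OF False l_def] by blast
next
  case True
  have "(y2 - y1) * (y1 + y2) = 0" using on_cubic_diff[OF P Q] True by simp
  then have y: "y2 = y1" using ne True by simp
  define l where "l = (3 * x1\<^sup>2 + 2 * a * x1 + b) / (2 * y1)"
  have nz: "y1 + y1 \<noteq> 0" using ne True y by simp
  then have "l * (y1 + y1) = 3 * x1\<^sup>2 + 2 * a * x1 + b" by (simp add: l_def flip: mult_2)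
  then show ?thesis
    using that[of l] ec_add_same[OF nz l_def] True y
    by (simp add: algebra_simps eval_nat_numeral)
qed

text \<open>\<open>x1\<close>, \<open>x2\<close> and \<open>x3\<close> are the roots of the cubic
  minus \<open>(l * x + n)\<^sup>2\<close>; Vieta's formulas express \<open>a\<close>,
  \<open>b\<close> and \<open>c\<close> by them, and the claim becomes an identity.\<close>

lemma on_cubic_third_point:
  fixes a b c :: "'a::field"
  assumes P: "on_cubic a b c x1 y1"
    and 1: "l * (x2 - x1) = y2 - y1"
    and 2: "l * (y1 + y2) = x1\<^sup>2 + x1 * x2 + x2\<^sup>2 + a * (x1 + x2) + b"
    and x3: "x3 = l\<^sup>2 - a - x1 - x2"
  shows "on_cubic a b c x3 (- l * x3 - (y1 - l * x1))"
proof -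
  define n where "n = y1 - l * x1"
  have a: "a = l\<^sup>2 - x1 - x2 - x3" using x3 by (simp add: algebra_simps)
  have y2: "y2 = l * x2 + n" using 1 by (simp add: n_def algebra_simps)
  have y1: "y1 = l * x1 + n" by (simp add: n_def)
  have b: "b = 2 * l * n + x1 * x2 + x1 * x3 + x2 * x3"
    using 2 unfolding y1 y2 a by (simp add: algebra_simps eval_nat_numeral)
  have c: "c = n\<^sup>2 - x1 * x2 * x3"
    using P unfolding on_cubic_def y1 a b by (simp add: algebra_simps eval_nat_numeral)
  have "(- l * x3 - n)\<^sup>2 = x3 ^ 3 + a * x3\<^sup>2 + b * x3 + c"
    unfolding a b c by (simp add: algebra_simps eval_nat_numeral)
  then show ?thesis by (simp add: on_cubic_def n_def)
qed

lemma ec_add_closed: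
  assumes "P \<in> ec_points (cubic_curve a b c)" "Q \<in> ec_points (cubic_curve a b c)"
  shows "ec_add (cubic_curve a b c) P Q \<in> ec_points (cubic_curve a b c)"
proof (cases P)
  case Neutral
  then show ?thesis using assms by simp
next
  case P: (Point x1 y1)
  show ?thesis
  proof (cases Q)
    case Neutral
    then show ?thesis using assms P by simp
  next
    case Q: (Point x2 y2)
    have on: "on_cubic a b c x1 y1" "on_cubic a b c x2 y2"
      using assms P Q by (auto simp: ec_points_cubic)
    show ?thesis
    proof (cases "x1 = x2 \<and> y1 + y2 = 0")
      case True
      then show ?thesis by (simp add: P Q ec_points_cubic)
    next
      case False
      obtain l where "l * (x2 - x1) = y2 - y1"
        "l * (y1 + y2) = x1\<^sup>2 + x1 * x2 + x2\<^sup>2 + a * (x1 + x2) + b"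
        "ec_add (cubic_curve a b c) (Point x1 y1) (Point x2 y2) =
           Point (l\<^sup>2 - a - x1 - x2) (- l * (l\<^sup>2 - a - x1 - x2) - (y1 - l * x1))"
        using ec_add_slope[OF on False] .
      then show ?thesis using on_cubic_third_point[OF on(1)]
        unfolding P Q ec_points_cubic by simp
    qed
  qed
qed

lemma ec_add_commute:
  assumes "on_cubic a b c x1 y1" "on_cubic a b c x2 y2"
  shows "ec_add (cubic_curve a b c) (Point x1 y1) (Point x2 y2) =
    ec_add (cubic_curve a b c) (Point x2 y2) (Point x1 y1)"
proof (cases "x1 = x2")
  case True
  then have "(y2 - y1) * (y1 + y2) = 0" using on_cubic_diff[OF assms] by simp
  then have "y1 = y2 \<or> y1 + y2 = 0" by auto
  then show ?thesis using True by (auto simp: add.commute)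
next
  case False
  define l where "l = (y2 - y1) / (x2 - x1)"
  have l': "l = (y1 - y2) / (x1 - x2)" unfolding l_def by (metis minus_diff_eq minus_divide_divide)
  have "y1 - l * x1 = y2 - l * x2" using False by (simp add: l_def field_simps)
  then show ?thesis
    unfolding ec_add_distinct[OF False l_def] ec_add_distinct[OF False[symmetric] l']
    by (simp add: algebra_simps)
qed

lemma ec_disc_cubic:
  "ec_disc (cubic_curve a b c) =
     16 * (a\<^sup>2 * b\<^sup>2 - 4 * b ^ 3 - 4 * a ^ 3 * c - 27 * c\<^sup>2 + 18 * a * b * c)"
  unfolding ec_disc_def Let_def by (simp add: algebra_simps eval_nat_numeral)

text \<open>A double root kills the discriminant: the two equations are solved for \<open>b\<close>
  and \<open>c\<close> and substituted.\<close>

lemma no_singular_point: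
  fixes a b c :: "'a::field"
  assumes "elliptic_curve (cubic_curve a b c)"
    and f: "x ^ 3 + a * x\<^sup>2 + b * x + c = 0" and f': "3 * x\<^sup>2 + 2 * a * x + b = 0"
  shows False
proof -
  have b: "b = - 3 * x\<^sup>2 - 2 * a * x" using f' by (simp add: algebra_simps eq_neg_iff_add_eq_0)
  have c: "c = 2 * x ^ 3 + a * x\<^sup>2"
    using f unfolding b by (simp add: algebra_simps eval_nat_numeral eq_neg_iff_add_eq_0)
  have "ec_disc (cubic_curve a b c) = 0"
    unfolding ec_disc_cubic b c by (simp add: algebra_simps eval_nat_numeral)
  then show False using assms(1) by (simp add: elliptic_curve_def)
qed

section \<open>Values and poles of rational functions\<close>

text \<open>As a relation it carries regularity and value together, so sums and products need no
  side conditions.\<close>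

definition has_value_at :: "'k::field \<Rightarrow> 'k poly fract \<Rightarrow> 'k \<Rightarrow> bool" where
  "has_value_at t f v \<longleftrightarrow> (\<exists>p q. f = Fract p q \<and> poly q t \<noteq> 0 \<and> v = poly p t / poly q t)"

lemma has_value_at_imp_subst_at: "has_value_at t f v \<Longrightarrow> subst_at t f = v"
  by (auto simp: has_value_at_def subst_at_Fract)

lemma regular_at_iff: "regular_at t f \<longleftrightarrow> (\<exists>v. has_value_at t f v)"
  by (auto simp: has_value_at_def regular_at_def)

lemma has_value_at_unique: "has_value_at t f v \<Longrightarrow> has_value_at t f w \<Longrightarrow> v = w"
  using has_value_at_imp_subst_at by blast

lemma has_value_at_to_fract [intro]: "has_value_at t (to_fract p) (poly p t)"
  unfolding has_value_at_def by (intro exI[of _ p] exI[of _ 1]) (simp add: to_fract_def)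

lemma has_value_at_add [intro]:
  assumes "has_value_at t f v" "has_value_at t g w"
  shows "has_value_at t (f + g) (v + w)"
proof -
  obtain p q p' q' where *: "f = Fract p q" "poly q t \<noteq> 0" "v = poly p t / poly q t"
    "g = Fract p' q'" "poly q' t \<noteq> 0" "w = poly p' t / poly q' t"
    using assms by (auto simp: has_value_at_def)
  then have "q \<noteq> 0" "q' \<noteq> 0" by auto
  then show ?thesis unfolding has_value_at_def *
    by (intro exI[of _ "p * q' + p' * q"] exI[of _ "q * q'"])
       (use * in \<open>simp add: add_frac_eq\<close>)
qed

lemma has_value_at_mult [intro]:
  assumes "has_value_at t f v" "has_value_at t g w"
  shows "has_value_at t (f * g) (v * w)"
proof -
  obtain p q p' q' where *: "f = Fract p q" "poly q t \<noteq> 0" "v = poly p t / poly q t"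
    "g = Fract p' q'" "poly q' t \<noteq> 0" "w = poly p' t / poly q' t"
    using assms by (auto simp: has_value_at_def)
  then show ?thesis unfolding has_value_at_def *
    by (intro exI[of _ "p * p'"] exI[of _ "q * q'"]) (use * in simp)
qed

lemma has_value_at_numeral [intro]: "has_value_at t (numeral n) (numeral n)"
proof -
  have "to_fract (of_nat k :: 'a poly) = of_nat k" for k by (induction k) simp_all
  from this[of "numeral n"] show ?thesis using has_value_at_to_fract[of t "numeral n"] by simp
qed

lemma has_value_at_0 [intro]: "has_value_at t 0 0"
  using has_value_at_to_fract[of t 0] by simp

lemma has_value_at_1 [intro]: "has_value_at t 1 1"
  using has_value_at_to_fract[of t 1] by simp

lemma has_value_at_minus [intro]: "has_value_at t f v \<Longrightarrow> has_value_at t (- f) (- v)"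
  using has_value_at_mult[OF has_value_at_to_fract[of t "- 1"], of f v] by simp

lemma has_value_at_diff [intro]:
  "has_value_at t f v \<Longrightarrow> has_value_at t g w \<Longrightarrow> has_value_at t (f - g) (v - w)"
  using has_value_at_add[OF _ has_value_at_minus] by fastforce

lemma has_value_at_power [intro]: "has_value_at t f v \<Longrightarrow> has_value_at t (f ^ n) (v ^ n)"
  by (induction n) auto

lemma has_value_at_inverse:
  assumes "has_value_at t f v" "v \<noteq> 0"
  shows "has_value_at t (1 / f) (1 / v)"
proof -
  obtain p q where *: "f = Fract p q" "poly q t \<noteq> 0" "v = poly p t / poly q t"
    using assms by (auto simp: has_value_at_def)
  then have "poly p t \<noteq> 0" using assms(2) by auto
  then show ?thesis unfolding has_value_at_def
    by (intro exI[of _ q] exI[of _ p]) (simp add: * One_fract_def)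
qed

lemma has_value_at_divide:
  assumes "has_value_at t f v" "has_value_at t g w" "w \<noteq> 0"
  shows "has_value_at t (f / g) (v / w)"
  using has_value_at_mult[OF assms(1) has_value_at_inverse[OF assms(2,3)]] by simp

text \<open>In a fraction with denominator of least degree, \<open>t\<close> is not a common zero of
  numerator and denominator.\<close>

lemma pole_at:
  assumes "\<not> regular_at t f"
  shows "f \<noteq> 0" "has_value_at t (1 / f) 0"
proof -
  show "f \<noteq> 0" using assms has_value_at_0 by (auto simp: regular_at_iff)
  have "\<exists>p q. f = Fract p q \<and> q \<noteq> 0" using Fract_cases by metis
  then obtain z where z: "f = Fract (fst z) (snd z) \<and> snd z \<noteq> 0"
    and min: "\<And>y. f = Fract (fst y) (snd y) \<and> snd y \<noteq> 0 \<Longrightarrow> degree (snd z) \<le> degree (snd y)"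
    using ex_has_least_nat[of "\<lambda>z. f = Fract (fst z) (snd z) \<and> snd z \<noteq> 0" _ "\<lambda>z. degree (snd z)"]
    by (metis fst_conv snd_conv)
  obtain p q where pq: "z = (p, q)" by (cases z)
  have q0: "poly q t = 0" using assms z by (auto simp: regular_at_def pq)
  have "poly p t \<noteq> 0"
  proof
    assume "poly p t = 0"
    then obtain p' q' where 1: "p = [:- t, 1:] * p'" "q = [:- t, 1:] * q'"
      using q0 by (auto simp: poly_eq_0_iff_dvd elim!: dvdE)
    have "q' \<noteq> 0" using z pq 1 by auto
    have "f = Fract ([:- t, 1:] * p') ([:- t, 1:] * q')" using z unfolding pq 1 fst_conv snd_conv by blast
    then have "f = Fract p' q'" using mult_fract_cancel[of "[:- t, 1:]" p' q'] by simp
    then have "degree q \<le> degree q'" using min[of "(p', q')"] \<open>q' \<noteq> 0\<close> pq by simp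
    moreover have "degree q = Suc (degree q')"
      using \<open>q' \<noteq> 0\<close> unfolding 1 by (subst degree_mult_eq) auto
    ultimately show False by simp
  qed
  then show "has_value_at t (1 / f) 0" unfolding has_value_at_def
    using z q0 by (intro exI[of _ q] exI[of _ p]) (simp add: pq One_fract_def)
qed

text \<open>A pole of \<open>f\<close> would give \<open>f\<^sup>2 * (1 / f)\<^sup>2 = 1\<close> the
  value 0.\<close>

lemma regular_at_of_square:
  assumes "regular_at t (f\<^sup>2)"
  shows "regular_at t f"
proof (rule ccontr)
  assume "\<not> regular_at t f"
  note pole = pole_at[OF this]
  obtain v where "has_value_at t (f\<^sup>2) v" using assms by (auto simp: regular_at_iff)
  then have "has_value_at t (f\<^sup>2 * (1 / f)\<^sup>2) (v * 0\<^sup>2)" using pole(2) by blast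
  moreover have "f\<^sup>2 * (1 / f)\<^sup>2 = 1" using pole(1) by (simp add: power_divide)
  ultimately show False using has_value_at_unique[OF has_value_at_1] by fastforce
qed

section \<open>Compatibility of specialization with the group law\<close>

locale specialized_cubic =
  fixes t0 :: "'k::field" and a b c :: "'k poly fract" and A B C :: 'k
  assumes coeffs: "has_value_at t0 a A" "has_value_at t0 b B" "has_value_at t0 c C"
    and smooth: "elliptic_curve (cubic_curve A B C)"
begin

text \<open>The factor 16 of the discriminant excludes characteristic 2.\<close>

lemma two_nz: "(2 :: 'k) \<noteq> 0"
proof
  assume "(2 :: 'k) = 0"
  moreover have "(16 :: 'k) = 2 * 8" by simp
  ultimately have "(16 :: 'k) = 0" by (metis mult_zero_left)
  then show False using smooth by (simp add: elliptic_curve_def ec_disc_cubic)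
qed

lemma on_cubic_value:
  assumes "on_cubic a b c x y" "has_value_at t0 x v" "has_value_at t0 y w"
  shows "on_cubic A B C v w"
proof -
  have "has_value_at t0 (y\<^sup>2) (v ^ 3 + A * v\<^sup>2 + B * v + C)"
    using assms coeffs unfolding on_cubic_def
    by (simp only:) (intro has_value_at_add has_value_at_mult has_value_at_power)
  moreover have "has_value_at t0 (y\<^sup>2) (w\<^sup>2)" using assms by blast
  ultimately show ?thesis unfolding on_cubic_def by (rule has_value_at_unique[symmetric])
qed

lemma regular_y:
  assumes "on_cubic a b c x y" "has_value_at t0 x v"
  obtains w where "has_value_at t0 y w" "on_cubic A B C v w"
proof -
  have "has_value_at t0 (y\<^sup>2) (v ^ 3 + A * v\<^sup>2 + B * v + C)"
    using assms coeffs unfolding on_cubic_def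
    by (simp only:) (intro has_value_at_add has_value_at_mult has_value_at_power)
  then have "regular_at t0 y" using regular_at_of_square regular_at_iff by blast
  then show ?thesis using that on_cubic_value[OF assms] regular_at_iff by blast
qed

lemma specialization_value:
  "has_value_at t0 x v \<Longrightarrow> has_value_at t0 y w \<Longrightarrow> specialization t0 (Point x y) = Point v w"
  by (auto simp: has_value_at_imp_subst_at regular_at_iff)

lemma specialization_pole: "\<not> regular_at t0 x \<Longrightarrow> specialization t0 (Point x y) = Neutral"
  by simp

text \<open>Dividing the curve equation by \<open>x ^ 3\<close> gives the value of
  \<open>y\<^sup>2 / x ^ 3\<close>; one more division by \<open>x\<close> gives that of the square
  of \<open>y / x\<^sup>2\<close>.\<close>

lemma pole_values:
  assumes on: "on_cubic a b c x y" and pole: "\<not> regular_at t0 x"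
  shows "x \<noteq> 0" "has_value_at t0 (1 / x) 0" "has_value_at t0 (y\<^sup>2 / x ^ 3) 1"
    "has_value_at t0 (y / x\<^sup>2) 0"
proof -
  show x: "x \<noteq> 0" and x0: "has_value_at t0 (1 / x) 0" using pole_at[OF pole] by blast+
  have "has_value_at t0 (1 + a * (1 / x) + b * (1 / x)\<^sup>2 + c * (1 / x) ^ 3)
      (1 + A * 0 + B * 0\<^sup>2 + C * 0 ^ 3)"
    using x0 coeffs
    by (intro has_value_at_add has_value_at_mult has_value_at_power has_value_at_1)
  moreover have "1 + a * (1 / x) + b * (1 / x)\<^sup>2 + c * (1 / x) ^ 3 = y\<^sup>2 / x ^ 3"
    using on x by (simp add: on_cubic_def field_simps eval_nat_numeral)
  ultimately show y2: "has_value_at t0 (y\<^sup>2 / x ^ 3) 1" by simp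
  have "has_value_at t0 (y\<^sup>2 / x ^ 3 * (1 / x)) (1 * 0)" using y2 x0 by blast
  moreover have "y\<^sup>2 / x ^ 3 * (1 / x) = (y / x\<^sup>2)\<^sup>2"
    using x by (simp add: field_simps eval_nat_numeral)
  ultimately have v: "has_value_at t0 ((y / x\<^sup>2)\<^sup>2) 0" by simp
  then have "regular_at t0 (y / x\<^sup>2)" using regular_at_of_square regular_at_iff by blast
  then obtain u where u: "has_value_at t0 (y / x\<^sup>2) u" using regular_at_iff by blast
  then have "has_value_at t0 ((y / x\<^sup>2)\<^sup>2) (u\<^sup>2)" by blast
  then have "u\<^sup>2 = 0" using v has_value_at_unique by blast
  then show "has_value_at t0 (y / x\<^sup>2) 0" using u by simp
qed

text \<open>The numerators of \<open>x\<^sub>3\<close> and \<open>y\<^sub>3\<close> are rewritten with the equation of the curve so that the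
  leading terms of the poles of \<open>x\<^sub>1\<close> and \<open>y\<^sub>1\<close> cancel.\<close>

lemma add_pole_value:
  assumes P: "on_cubic a b c x1 y1" and pole: "\<not> regular_at t0 x1"
    and Q: "on_cubic a b c x2 y2" "has_value_at t0 x2 v" "has_value_at t0 y2 w"
    and l: "l = (y2 - y1) / (x2 - x1)" and x3: "x3 = l\<^sup>2 - a - x1 - x2"
  shows "has_value_at t0 x3 v" "has_value_at t0 (- l * x3 - (y1 - l * x1)) w"
proof -
  note pv = pole_values[OF P pole]
  have ne: "x1 \<noteq> x2" using pole Q(2) regular_at_iff by blast
  define X Z U where "X = 1 / x1" and "Z = y1 / x1\<^sup>2" and "U = y1\<^sup>2 / x1 ^ 3"
  have XZU: "has_value_at t0 X 0" "has_value_at t0 Z 0" "has_value_at t0 U 1"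
    using pv by (simp_all add: X_def Z_def U_def)
  define b1 c1 where "b1 = b + x2\<^sup>2 + 2 * a * x2" and "c1 = c + y2\<^sup>2 - x2 ^ 3 - a * x2\<^sup>2"
  have "x3 * (x1 - x2)\<^sup>2 = (l * (x2 - x1))\<^sup>2 - (a + x1 + x2) * (x1 - x2)\<^sup>2"
    unfolding x3 by (simp add: algebra_simps eval_nat_numeral)
  also have "l * (x2 - x1) = y2 - y1" using ne by (simp add: l)
  also have "(y2 - y1)\<^sup>2 - (a + x1 + x2) * (x1 - x2)\<^sup>2 =
      y1\<^sup>2 - (x1 ^ 3 + a * x1\<^sup>2 + b * x1 + c) + x1\<^sup>2 * x2 + x1 * b1 + c1 - 2 * y1 * y2"
    unfolding b1_def c1_def by (simp add: algebra_simps eval_nat_numeral)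
  also have "\<dots> = x1\<^sup>2 * x2 + x1 * b1 + c1 - 2 * y1 * y2"
    using P by (simp add: on_cubic_def)
  finally have num: "x3 * (x1 - x2)\<^sup>2 = x1\<^sup>2 * x2 + x1 * b1 + c1 - 2 * y1 * y2" .
  obtain \<beta> \<gamma> where b1: "has_value_at t0 b1 \<beta>" and c1: "has_value_at t0 c1 \<gamma>"
    unfolding b1_def c1_def using Q coeffs
    by (meson has_value_at_add has_value_at_diff has_value_at_mult has_value_at_power
        has_value_at_numeral)
  have x1: "x1 \<noteq> 0" by (rule pv(1))
  have den: "has_value_at t0 (1 - x2 * X) (1 - v * 0)"
    using Q XZU by (intro has_value_at_diff has_value_at_mult has_value_at_1)
  have den_eq: "1 - x2 * X = (x1 - x2) / x1" using x1 by (simp add: X_def field_simps)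
  have "has_value_at t0 ((x2 + X * b1 + X\<^sup>2 * c1 - 2 * Z * y2) / (1 - x2 * X)\<^sup>2)
      ((v + 0 * \<beta> + 0\<^sup>2 * \<gamma> - 2 * 0 * w) / (1 - v * 0)\<^sup>2)"
    using Q XZU b1 c1 den
    by (intro has_value_at_divide has_value_at_add has_value_at_diff has_value_at_mult
        has_value_at_power has_value_at_numeral) auto
  moreover have "(x2 + X * b1 + X\<^sup>2 * c1 - 2 * Z * y2) / (1 - x2 * X)\<^sup>2 = x3"
  proof -
    have "x2 + X * b1 + X\<^sup>2 * c1 - 2 * Z * y2 = (x1\<^sup>2 * x2 + x1 * b1 + c1 - 2 * y1 * y2) / x1\<^sup>2"
      using x1 by (simp add: X_def Z_def field_simps eval_nat_numeral)
    then show ?thesis unfolding num[symmetric] den_eq using ne x1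
      by (simp add: power_divide)
  qed
  ultimately show "has_value_at t0 x3 v" by simp
  define g where "g = x1 * (b1 + 2 * x2\<^sup>2) + (c1 - x2 ^ 3) - 2 * y1 * y2"
  have g: "(x3 - x2) * (x1 - x2)\<^sup>2 = g"
    using num by (simp add: g_def algebra_simps eval_nat_numeral)
  \<comment> \<open>Adding \<open>y2\<close> brings in the factor \<open>x3 - x2\<close>, in whose
    numerator \<open>g\<close> the term with \<open>x1\<^sup>2\<close> has cancelled.\<close>
  have y3: "- l * x3 - (y1 - l * x1) + y2 = (y2 - y1) * g / (x1 - x2) ^ 3"
  proof -
    have ll: "l * (x1 - x2) = y1 - y2" using ne by (simp add: l field_simps)
    have "(- l * x3 - (y1 - l * x1) + y2) = - l * (x3 - x2) - (y1 - y2 - l * (x1 - x2))"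
      by (simp add: algebra_simps)
    then have "- l * x3 - (y1 - l * x1) + y2 = - l * (x3 - x2)" by (simp add: ll)
    then have "(- l * x3 - (y1 - l * x1) + y2) * (x1 - x2) ^ 3 =
        - (l * (x1 - x2)) * ((x3 - x2) * (x1 - x2)\<^sup>2)"
      by (simp add: eval_nat_numeral)
    then show ?thesis unfolding g ll using ne by (simp add: eq_divide_eq)
  qed
  define b2 c2 where "b2 = b1 + 2 * x2\<^sup>2" and "c2 = c1 - x2 ^ 3"
  obtain \<beta>' \<gamma>' where b2: "has_value_at t0 b2 \<beta>'" and c2: "has_value_at t0 c2 \<gamma>'"
    unfolding b2_def c2_def using Q b1 c1
    by (meson has_value_at_add has_value_at_diff has_value_at_mult has_value_at_power
        has_value_at_numeral)
  \<comment> \<open>Only \<open>2 * U * y2\<close> survives in the numerator, so the value is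
    \<open>2 * w - w\<close>.\<close>
  have val: "has_value_at t0 ((y2 * b2 * X\<^sup>2 + y2 * c2 * X ^ 3 - 2 * Z * X * y2\<^sup>2 - Z * b2 - Z * X * c2 + 2 * U * y2)
        / (1 - x2 * X) ^ 3 - y2)
      ((w * \<beta>' * 0\<^sup>2 + w * \<gamma>' * 0 ^ 3 - 2 * 0 * 0 * w\<^sup>2 - 0 * \<beta>' - 0 * 0 * \<gamma>' + 2 * 1 * w)
        / (1 - v * 0) ^ 3 - w)"
    using Q XZU b2 c2 den
    by (intro has_value_at_divide has_value_at_add has_value_at_diff has_value_at_mult
        has_value_at_power has_value_at_numeral) auto
  have num: "y2 * b2 * X\<^sup>2 + y2 * c2 * X ^ 3 - 2 * Z * X * y2\<^sup>2 - Z * b2 - Z * X * c2 + 2 * U * y2 =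
      (y2 - y1) * g / x1 ^ 3"
  proof -
    have "(y2 - y1) * g / x1 ^ 3 = (y2 - y1) * (x1 * b2 + c2 - 2 * y1 * y2) * X ^ 3"
      by (simp add: g_def b2_def c2_def X_def power_one_over divide_inverse power_inverse)
    also have "\<dots> = (y2 - y1) * ((x1 * X) * X\<^sup>2 * b2 + c2 * X ^ 3 - 2 * y1 * y2 * X ^ 3)"
      by (simp add: algebra_simps eval_nat_numeral)
    also have "x1 * X = 1" using x1 by (simp add: X_def)
    finally have fin: "(y2 - y1) * g / x1 ^ 3 =
      (y2 - y1) * (1 * X\<^sup>2 * b2 + c2 * X ^ 3 - 2 * y1 * y2 * X ^ 3)" .
    have Z: "Z = y1 * X\<^sup>2" and U: "U = y1\<^sup>2 * X ^ 3"
      by (simp_all add: Z_def U_def X_def power_one_over divide_inverse power_inverse)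
    show ?thesis unfolding fin Z U by (simp add: algebra_simps eval_nat_numeral)
  qed
  have quot: "(y2 - y1) * g / x1 ^ 3 / (1 - x2 * X) ^ 3 = (y2 - y1) * g / (x1 - x2) ^ 3"
    unfolding den_eq using x1 ne by (simp add: power_divide)
  have "has_value_at t0 ((- l * x3 - (y1 - l * x1) + y2) - y2) w"
    using val unfolding num quot y3 by simp
  then show "has_value_at t0 (- l * x3 - (y1 - l * x1)) w" by simp
qed

lemma specialization_add_pole_regular:
  assumes P: "on_cubic a b c x1 y1" "\<not> regular_at t0 x1"
    and Q: "on_cubic a b c x2 y2" "has_value_at t0 x2 v" "has_value_at t0 y2 w"
  shows "specialization t0 (ec_add (cubic_curve a b c) (Point x1 y1) (Point x2 y2)) = Point v w"
proof -
  have ne: "x1 \<noteq> x2" using P Q(2) regular_at_iff by blast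
  show ?thesis
    unfolding ec_add_distinct[OF ne refl]
    by (intro specialization_value add_pole_value[OF P Q refl refl])
qed

text \<open>Otherwise \<open>Q = (P + Q) + (- P)\<close> would be a sum of a regular point and a pole, hence regular.\<close>

lemma not_regular_add_poles:
  assumes P: "on_cubic a b c x1 y1" "\<not> regular_at t0 x1"
    and R: "on_cubic a b c x3 y3"
    and l: "l * (x2 - x1) = y2 - y1" and x3: "x3 = l\<^sup>2 - a - x1 - x2"
    and y3: "y3 = - l * x3 - (y1 - l * x1)" and pole: "\<not> regular_at t0 x2"
  shows "\<not> regular_at t0 x3"
proof
  assume "regular_at t0 x3"
  then obtain v where v: "has_value_at t0 x3 v" using regular_at_iff by blast
  obtain w where w: "has_value_at t0 y3 w" using regular_y[OF R v] .
  have ne: "x3 - x1 \<noteq> 0" using v P(2) regular_at_iff by auto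
  have "y3 - (- y1) = - l * (x3 - x1)" by (simp add: y3 algebra_simps)
  then have l': "- l = (y3 - (- y1)) / (x3 - x1)" using ne by (simp add: eq_divide_eq)
  have x2: "x2 = (- l)\<^sup>2 - a - x1 - x3" by (simp add: x3)
  have "has_value_at t0 x2 v"
    using P by (intro add_pole_value(1)[OF _ P(2) R v w l' x2]) simp
  then show False using pole regular_at_iff by blast
qed

text \<open>The chord expression of the slope specializes if \<open>v1 \<noteq> v2\<close>, the
  other expression if \<open>w1 + w2 \<noteq> 0\<close>. If both denominators vanish, the sum has a
  pole.\<close>

lemma specialization_add_regular:
  assumes P: "on_cubic a b c x1 y1" "has_value_at t0 x1 v1" "has_value_at t0 y1 w1"
    and Q: "on_cubic a b c x2 y2" "has_value_at t0 x2 v2" "has_value_at t0 y2 w2"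
    and ne: "\<not> (x1 = x2 \<and> y1 + y2 = 0)"
  shows "specialization t0 (ec_add (cubic_curve a b c) (Point x1 y1) (Point x2 y2)) =
    ec_add (cubic_curve A B C) (Point v1 w1) (Point v2 w2)"
proof -
  have P0: "on_cubic A B C v1 w1" and Q0: "on_cubic A B C v2 w2"
    using on_cubic_value P Q by blast+
  obtain l where l1: "l * (x2 - x1) = y2 - y1"
    and l2: "l * (y1 + y2) = x1\<^sup>2 + x1 * x2 + x2\<^sup>2 + a * (x1 + x2) + b"
    and add: "ec_add (cubic_curve a b c) (Point x1 y1) (Point x2 y2) =
       Point (l\<^sup>2 - a - x1 - x2) (- l * (l\<^sup>2 - a - x1 - x2) - (y1 - l * x1))"
    using ec_add_slope[OF P(1) Q(1) ne] .
  have val: "specialization t0 (ec_add (cubic_curve a b c) (Point x1 y1) (Point x2 y2)) =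
       Point (s\<^sup>2 - A - v1 - v2) (- s * (s\<^sup>2 - A - v1 - v2) - (w1 - s * v1))"
    if "has_value_at t0 l s" for s
    unfolding add using that coeffs P Q
    by (intro specialization_value has_value_at_diff has_value_at_power has_value_at_mult
        has_value_at_minus)
  have num: "has_value_at t0 (x1\<^sup>2 + x1 * x2 + x2\<^sup>2 + a * (x1 + x2) + b)
      (v1\<^sup>2 + v1 * v2 + v2\<^sup>2 + A * (v1 + v2) + B)"
    using coeffs P Q by (intro has_value_at_add has_value_at_mult has_value_at_power)
  have dx: "has_value_at t0 (x2 - x1) (v2 - v1)" and dy: "has_value_at t0 (y2 - y1) (w2 - w1)"
    and sy: "has_value_at t0 (y1 + y2) (w1 + w2)"
    using P Q by blast+
  show ?thesis
  proof (cases "v1 = v2")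
    case False
    then have "x2 - x1 \<noteq> 0" using has_value_at_unique[OF P(2), of v2] Q(2) by auto
    then have "l = (y2 - y1) / (x2 - x1)" using l1 by (simp add: eq_divide_eq)
    then have "has_value_at t0 l ((w2 - w1) / (v2 - v1))"
      using has_value_at_divide[OF dy dx] False by simp
    from val[OF this] show ?thesis unfolding ec_add_distinct[OF False refl] .
  next
    case v: True
    have "(w2 - w1) * (w1 + w2) = 0" using on_cubic_diff[OF P0 Q0] v by simp
    then have ww: "w2 = w1 \<or> w1 + w2 = 0" by auto
    show ?thesis
    proof (cases "w1 + w2 = 0")
      case False
      then have w: "w2 = w1" using ww by simp
      have "y1 + y2 \<noteq> 0" using sy False has_value_at_unique[OF has_value_at_0] by metis
      then have "l = (x1\<^sup>2 + x1 * x2 + x2\<^sup>2 + a * (x1 + x2) + b) / (y1 + y2)"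
        using l2 by (simp add: eq_divide_eq)
      then have "has_value_at t0 l ((v1\<^sup>2 + v1 * v2 + v2\<^sup>2 + A * (v1 + v2) + B) / (w1 + w2))"
        using has_value_at_divide[OF num sy False] by simp
      also have "(v1\<^sup>2 + v1 * v2 + v2\<^sup>2 + A * (v1 + v2) + B) / (w1 + w2) =
          (3 * v1\<^sup>2 + 2 * A * v1 + B) / (2 * w1)"
        unfolding w v[symmetric] by (simp add: algebra_simps eval_nat_numeral)
      finally have l: "has_value_at t0 l ((3 * v1\<^sup>2 + 2 * A * v1 + B) / (2 * w1))" .
      have nz: "w1 + w1 \<noteq> 0" using False w by simp
      show ?thesis
        using val[OF l] unfolding w v[symmetric] ec_add_same[OF nz refl] .
    next
      case w: True
      \<comment> \<open>If it were regular, so would be \<open>l\<close>, and the two slope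
        relations would specialize to the conditions for a singular point.\<close>
      have "\<not> regular_at t0 (l\<^sup>2 - a - x1 - x2)"
      proof
        assume "regular_at t0 (l\<^sup>2 - a - x1 - x2)"
        then obtain \<xi> where "has_value_at t0 (l\<^sup>2 - a - x1 - x2) \<xi>" using regular_at_iff by blast
        then have "has_value_at t0 ((l\<^sup>2 - a - x1 - x2) + a + x1 + x2) (\<xi> + A + v1 + v2)"
          using coeffs P Q by (intro has_value_at_add)
        then have "has_value_at t0 (l\<^sup>2) (\<xi> + A + v1 + v2)" by simp
        then obtain s where s: "has_value_at t0 l s"
          using regular_at_of_square regular_at_iff by blast
        have "s * (v2 - v1) = w2 - w1"
          using has_value_at_unique has_value_at_mult[OF s dx] dy l1 by metis
        then have "2 * w1 = 0" using v w by (simp add: algebra_simps)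
        then have w1: "w1 = 0" using two_nz by simp
        have "s * (w1 + w2) = v1\<^sup>2 + v1 * v2 + v2\<^sup>2 + A * (v1 + v2) + B"
          using has_value_at_unique has_value_at_mult[OF s sy] num l2 by metis
        then have "3 * v1\<^sup>2 + 2 * A * v1 + B = 0" using v w
          by (simp add: algebra_simps eval_nat_numeral)
        moreover have "v1 ^ 3 + A * v1\<^sup>2 + B * v1 + C = 0" using P0 w1 by (simp add: on_cubic_def)
        ultimately show False using no_singular_point[OF smooth] by blast
      qed
      then show ?thesis unfolding add using v w by simp
    qed
  qed
qed

lemma specialization_in_points:
  assumes "P \<in> ec_points (cubic_curve a b c)"
  shows "specialization t0 P \<in> ec_points (cubic_curve A B C)"
proof (cases P)
  case (Point x y)
  have on: "on_cubic a b c x y" using assms Point by (simp add: ec_points_cubic)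
  show ?thesis
  proof (cases "regular_at t0 x")
    case True
    then obtain v where v: "has_value_at t0 x v" using regular_at_iff by blast
    obtain w where w: "has_value_at t0 y w" "on_cubic A B C v w" using regular_y[OF on v] .
    then show ?thesis unfolding Point specialization_value[OF v w(1)] by (simp add: ec_points_cubic)
  next
    case False
    then show ?thesis using Point by (simp add: ec_points_def)
  qed
qed (simp add: ec_points_def)

lemma specialization_add:
  assumes "P \<in> ec_points (cubic_curve a b c)" "Q \<in> ec_points (cubic_curve a b c)"
  shows "specialization t0 (ec_add (cubic_curve a b c) P Q) =
    ec_add (cubic_curve A B C) (specialization t0 P) (specialization t0 Q)"
proof (cases "P = Neutral \<or> Q = Neutral")
  case True
  have right: "ec_add W R Neutral = R" for W :: "'f::field weierstrass" and R by (cases R) simp_all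
  from True show ?thesis by (auto simp: right)
next
  case False
  then obtain x1 y1 x2 y2 where PQ: "P = Point x1 y1" "Q = Point x2 y2"
    by (metis ec_point.exhaust)
  have P: "on_cubic a b c x1 y1" and Q: "on_cubic a b c x2 y2"
    using assms PQ by (auto simp: ec_points_cubic)
  show ?thesis
  proof (cases "x1 = x2 \<and> y1 + y2 = 0")
    case True
    then have y2: "x2 = x1" "y2 = - y1" by (auto simp: eq_neg_iff_add_eq_0 add.commute)
    show ?thesis
    proof (cases "regular_at t0 x1")
      case r: True
      then obtain v where v: "has_value_at t0 x1 v" using regular_at_iff by blast
      obtain w where w: "has_value_at t0 y1 w" using regular_y[OF P v] .
      show ?thesis unfolding PQ y2 ec_add_opposite
        using specialization_value[OF v w] specialization_value[OF v has_value_at_minus[OF w]] by simp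
    qed (simp add: PQ y2)
  next
    case ne: False
    obtain l where l: "l * (x2 - x1) = y2 - y1"
        "l * (y1 + y2) = x1\<^sup>2 + x1 * x2 + x2\<^sup>2 + a * (x1 + x2) + b"
      and add: "ec_add (cubic_curve a b c) (Point x1 y1) (Point x2 y2) =
         Point (l\<^sup>2 - a - x1 - x2) (- l * (l\<^sup>2 - a - x1 - x2) - (y1 - l * x1))"
      using ec_add_slope[OF P Q ne] .
    show ?thesis
    proof (cases "regular_at t0 x1")
      case True
      then obtain v1 where v1: "has_value_at t0 x1 v1" using regular_at_iff by blast
      obtain w1 where w1: "has_value_at t0 y1 w1" using regular_y[OF P v1] .
      show ?thesis
      proof (cases "regular_at t0 x2")
        case True
        then obtain v2 where v2: "has_value_at t0 x2 v2" using regular_at_iff by blast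
        obtain w2 where w2: "has_value_at t0 y2 w2" using regular_y[OF Q v2] .
        show ?thesis unfolding PQ specialization_value[OF v1 w1] specialization_value[OF v2 w2]
          by (rule specialization_add_regular[OF P v1 w1 Q v2 w2 ne])
      next
        case False
        show ?thesis
          unfolding PQ specialization_pole[OF False] ec_add_commute[OF P Q]
            specialization_add_pole_regular[OF Q False P v1 w1] specialization_value[OF v1 w1]
          by simp
      qed
    next
      case p1: False
      show ?thesis
      proof (cases "regular_at t0 x2")
        case True
        then obtain v2 where v2: "has_value_at t0 x2 v2" using regular_at_iff by blast
        obtain w2 where w2: "has_value_at t0 y2 w2" using regular_y[OF Q v2] .
        show ?thesis unfolding PQ specialization_pole[OF p1]
            specialization_add_pole_regular[OF P p1 Q v2 w2] specialization_value[OF v2 w2]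
          by simp
      next
        case p2: False
        have "\<not> regular_at t0 (l\<^sup>2 - a - x1 - x2)"
          by (rule not_regular_add_poles[OF P p1 _ l(1) refl refl p2])
             (rule on_cubic_third_point[OF P l refl])
        then show ?thesis unfolding PQ add using p1 p2 by simp
      qed
    qed
  qed
qed

lemma specialization_hom:
  "specialization t0 \<in> hom (ec_group (cubic_curve a b c)) (ec_group (cubic_curve A B C))"
  by (auto simp: hom_def ec_group_def specialization_in_points specialization_add)

text \<open>Points with regular abscissa never specialize to \<open>Neutral\<close>, so the kernel
  is trivial; for equal images this is applied to the sum of \<open>P\<close> and the opposite of
  \<open>Q\<close>.\<close>

lemma inj_on_specialization:
  assumes reg: "\<And>x y. on_cubic a b c x y \<Longrightarrow> regular_at t0 x"
  shows "inj_on (specialization t0) (ec_points (cubic_curve a b c))"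
proof
  fix P Q
  assume PQ: "P \<in> ec_points (cubic_curve a b c)" "Q \<in> ec_points (cubic_curve a b c)"
    and eq: "specialization t0 P = specialization t0 Q"
  have kernel: "R = Neutral"
    if inR: "R \<in> ec_points (cubic_curve a b c)" and R0: "specialization t0 R = Neutral" for R
  proof (rule ccontr)
    assume "R \<noteq> Neutral"
    then obtain x y where R: "R = Point x y" "on_cubic a b c x y"
      using inR by (cases R) (auto simp: ec_points_cubic)
    then obtain v where v: "has_value_at t0 x v" using reg regular_at_iff by blast
    obtain w where "has_value_at t0 y w" using regular_y[OF R(2) v] .
    then show False using R0 specialization_value[OF v] unfolding R by simp
  qed
  show "P = Q"
  proof (cases "P = Neutral \<or> Q = Neutral")
    case True
    then show ?thesis using kernel PQ eq by (metis specialization.simps(1))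
  next
    case False
    then obtain x1 y1 x2 y2 where P: "P = Point x1 y1" "on_cubic a b c x1 y1"
      and Q: "Q = Point x2 y2" "on_cubic a b c x2 y2"
      using PQ by (auto simp: ec_points_cubic)
    obtain v where v: "has_value_at t0 x2 v" using reg[OF Q(2)] regular_at_iff by blast
    obtain w where w: "has_value_at t0 y2 w" using regular_y[OF Q(2) v] .
    have Q': "Point x2 (- y2) \<in> ec_points (cubic_curve a b c)"
      using Q by (simp add: ec_points_cubic)
    have "specialization t0 (ec_add (cubic_curve a b c) P (Point x2 (- y2))) =
        ec_add (cubic_curve A B C) (Point v w) (Point v (- w))"
      unfolding specialization_add[OF PQ(1) Q'] eq unfolding Q(1)
        specialization_value[OF v w] specialization_value[OF v has_value_at_minus[OF w]] ..
    then have "ec_add (cubic_curve a b c) P (Point x2 (- y2)) = Neutral"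
      using kernel[OF ec_add_closed[OF PQ(1) Q']] by simp
    \<comment> \<open>Two affine points have sum \<open>Neutral\<close> only if they are opposite,
      so \<open>P = Q\<close> can be read off without cancellation in a group.\<close>
    then have "x1 = x2 \<and> y1 + - y2 = 0"
      unfolding P by (simp add: Let_def split: if_splits)
    then show ?thesis by (simp add: P Q)
  qed
qed

end

section \<open>The field of fractions of the coefficient ring\<close>

text \<open>The powers of \<open>x\<close> up to exponent \<open>card B\<close> are linearly
  dependent if distinct; otherwise two equal powers give a polynomial directly.\<close>

lemma number_field_algebraic:
  fixes x :: "'k::field_char_0"
  assumes "number_field TYPE('k)"
  shows "algebraic x"
proof -
  interpret Q: vector_space "\<lambda>(q::rat) (x::'k). of_rat q * x"
    by standard (simp_all add: algebra_simps of_rat_add of_rat_mult)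
  obtain B :: "'k set" where B: "finite B" "Q.span B = UNIV"
    using assms by (auto simp: number_field_def)
  define n where "n = card B"
  show ?thesis
  proof (cases "inj_on (\<lambda>i. x ^ i) {..n}")
    case True
    define S where "S = (\<lambda>i. x ^ i) ` {..n}"
    have "card S = Suc n" using True by (simp add: S_def card_image)
    then have "Q.dependent S"
      using Q.independent_span_bound[OF B(1), of S] B(2) by (auto simp: n_def)
    then obtain u i where u: "(\<Sum>v\<in>S. of_rat (u v) * v) = 0" "i \<le> n" "u (x ^ i) \<noteq> 0"
      by (subst (asm) Q.dependent_finite) (auto simp: S_def)
    define p where "p = (\<Sum>i\<le>n. monom (of_rat (u (x ^ i)) :: 'k) i)"
    have coeff: "coeff p m = (if m \<le> n then of_rat (u (x ^ m)) else 0)" for m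
      by (simp add: p_def coeff_sum)
    show ?thesis
    proof (rule algebraicI')
      show "coeff p m \<in> \<rat>" for m by (simp add: coeff)
      show "p \<noteq> 0" using u(2,3) coeff[of i] by auto
      have "poly p x = (\<Sum>i\<le>n. of_rat (u (x ^ i)) * x ^ i)"
        by (simp add: p_def poly_sum poly_monom)
      also have "\<dots> = (\<Sum>v\<in>S. of_rat (u v) * v)"
        using True by (simp add: S_def sum.reindex)
      finally show "poly p x = 0" using u(1) by simp
    qed
  next
    case False
    then obtain i j where ij: "x ^ i = x ^ j" "i \<noteq> j" by (auto simp: inj_on_def)
    show ?thesis
    proof (rule algebraicI)
      show "coeff (monom 1 i - monom 1 j :: 'k poly) m \<in> \<int>" for m by auto
      show "monom 1 i - monom 1 j \<noteq> (0 :: 'k poly)" using ij by (simp add: monom_eq_iff')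
      show "poly (monom 1 i - monom 1 j) x = 0" using ij by (simp add: poly_monom)
    qed
  qed
qed

text \<open>With leading coefficient \<open>c\<close> and degree \<open>n\<close>, multiplying the
  equation by \<open>c ^ (n - 1)\<close> makes it monic in \<open>c * x\<close>.\<close>

lemma algebraic_int_multiple:
  fixes x :: "'k::field_char_0"
  assumes "algebraic x"
  obtains c :: int where "c \<noteq> 0" "algebraic_int (of_int c * x)"
proof -
  obtain p where p: "p \<noteq> 0" "poly (map_poly of_int p) x = 0"
    using assms by (rule algebraicE')
  define n c where "n = degree p" and "c = lead_coeff p"
  have c: "c \<noteq> 0" using p by (simp add: c_def)
  have root: "(\<Sum>i\<le>n. of_int (coeff p i) * x ^ i) = 0"
    using p(2) by (simp add: poly_altdef degree_map_poly coeff_map_poly n_def)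
  have n: "n > 0"
  proof (rule ccontr)
    assume "\<not> n > 0"
    then have n0: "n = 0" by simp
    then have "of_int (coeff p 0) = (0 :: 'k)" using root by simp
    moreover have "c = coeff p 0" using n0 by (simp add: c_def n_def)
    ultimately show False using c by simp
  qed
  define a where "a i = (if i = n then 1 else coeff p i * c ^ (n - 1 - i))" for i
  define q where "q = (\<Sum>i\<le>n. monom (of_int (a i) :: 'k) i)"
  have coeff: "coeff q m = (if m \<le> n then of_int (a m) else 0)" for m
    by (simp add: q_def coeff_sum)
  have "degree q = n"
    by (rule antisym[OF degree_le le_degree]) (auto simp: coeff a_def)
  have "algebraic_int (of_int c * x)"
  proof (rule algebraic_int.intros)
    show "lead_coeff q = 1" unfolding \<open>degree q = n\<close> by (simp add: coeff a_def)
    show "\<forall>i. coeff q i \<in> \<int>" by (simp add: coeff)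
    have "of_int (a i) * (of_int c * x) ^ i = of_int (c ^ (n - 1)) * (of_int (coeff p i) * x ^ i)"
      if "i \<le> n" for i
    proof (cases "i = n")
      case True
      have "(of_int c :: 'k) ^ n = of_int c ^ (n - 1) * of_int c"
        using n by (metis Suc_diff_1 power_Suc2)
      then show ?thesis using True by (simp add: a_def power_mult_distrib c_def n_def)
    next
      case False
      then have "(of_int c :: 'k) ^ (n - 1) = of_int c ^ (n - 1 - i) * of_int c ^ i"
        using that n by (simp flip: power_add)
      then show ?thesis using False by (simp add: a_def power_mult_distrib)
    qed
    then have "poly q (of_int c * x) =
        (\<Sum>i\<le>n. of_int (c ^ (n - 1)) * (of_int (coeff p i) * x ^ i))"
      by (auto simp: q_def poly_sum poly_monom intro!: sum.cong)
    then show "poly q (of_int c * x) = 0" using root by (simp flip: sum_distrib_left)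
  qed
  then show ?thesis using that c by blast
qed

section \<open>Ring embeddings and polynomials over the subring\<close>

locale embedded_ring =
  fixes \<iota> :: "'r::comm_ring_1 \<Rightarrow> 'k::field_char_0"
  assumes emb: "ring_embedding \<iota>"
begin

lemma emb_simps [simp]: "\<iota> 1 = 1" "\<iota> (x + y) = \<iota> x + \<iota> y" "\<iota> (x * y) = \<iota> x * \<iota> y"
    "\<iota> x = \<iota> y \<longleftrightarrow> x = y"
  using emb by (auto simp: ring_embedding_def inj_def)

lemma emb_0 [simp]: "\<iota> 0 = 0"
  using emb_simps(2)[of 0 0] by simp

lemma emb_eq_0_iff [simp]: "\<iota> x = 0 \<longleftrightarrow> x = 0"
  using emb_simps(4)[of x 0] by simp

lemma emb_minus [simp]: "\<iota> (- x) = - \<iota> x"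
  using emb_simps(2)[of x "- x"] by (simp add: eq_neg_iff_add_eq_0 add.commute)

lemma emb_of_int [simp]: "\<iota> (of_int n) = of_int n"
proof -
  have "\<iota> (of_nat n) = of_nat n" for n by (induction n) simp_all
  then show ?thesis by (cases n rule: int_cases2) simp_all
qed

lemma map_poly_add: "map_poly \<iota> (p + q) = map_poly \<iota> p + map_poly \<iota> q"
  by (intro poly_eqI) (simp add: coeff_map_poly)

lemma map_poly_mult: "map_poly \<iota> (p * q) = map_poly \<iota> p * map_poly \<iota> q"
proof (induction p)
  case (pCons a p)
  then show ?case by (simp add: map_poly_pCons map_poly_add map_poly_smult)
qed simp

lemma map_poly_eq_iff: "map_poly \<iota> p = map_poly \<iota> q \<longleftrightarrow> p = q"
proof
  assume "map_poly \<iota> p = map_poly \<iota> q"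
  then have "coeff (map_poly \<iota> p) n = coeff (map_poly \<iota> q) n" for n by simp
  then show "p = q" by (intro poly_eqI) (simp add: coeff_map_poly)
qed simp

lemma ring_embedding_ratfun: "ring_embedding (ratfun \<iota>)"
  by (auto simp: ring_embedding_def ratfun_def map_poly_add map_poly_mult inj_def map_poly_eq_iff)

end

lemma ring_embedding_comp: "ring_embedding f \<Longrightarrow> ring_embedding g \<Longrightarrow> ring_embedding (\<lambda>x. f (g x))"
  by (auto simp: ring_embedding_def inj_def)

lemma ring_embedding_simps:
  assumes "ring_embedding f"
  shows "f 0 = 0" "f 1 = 1" "f (x + y) = f x + f y" "f (x * y) = f x * f y" "f (- x) = - f x"
    "f (x - y) = f x - f y" "f (x ^ n) = f x ^ n" "f (numeral k) = numeral k" "f x = f y \<longleftrightarrow> x = y"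
proof -
  have 1: "f 1 = 1" "f (x + y) = f x + f y" "f (x * y) = f x * f y" for x y
    using assms by (auto simp: ring_embedding_def)
  show 0: "f 0 = 0" using 1(2)[of 0 0] by simp
  show minus: "f (- x) = - f x" for x
    using 1(2)[of x "- x"] 0 by (simp add: eq_neg_iff_add_eq_0 add.commute)
  show "f 1 = 1" "f (x + y) = f x + f y" "f (x * y) = f x * f y" by (fact 1)+
  show "f (x - y) = f x - f y" using 1(2)[of x "- y"] minus by simp
  show "f (x ^ n) = f x ^ n" by (induction n) (simp_all add: 1)
  have "f (of_nat m) = of_nat m" for m by (induction m) (simp_all add: 0 1)
  from this[of "numeral k"] show "f (numeral k) = numeral k" by simp
  show "f x = f y \<longleftrightarrow> x = y" using assms by (auto simp: ring_embedding_def inj_def)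
qed

locale fraction_embedding = embedded_ring \<iota>
  for \<iota> :: "'r::{factorial_ring_gcd,semiring_gcd_mult_normalize} \<Rightarrow> 'k::field_char_0" +
  assumes quotient: "\<exists>a b. b \<noteq> 0 \<and> x * \<iota> b = \<iota> a"
begin

definition eval_at :: "'k \<Rightarrow> 'r poly \<Rightarrow> 'k" where
  "eval_at t f = poly (map_poly \<iota> f) t"

lemma eval_at_simps [simp]:
  "eval_at t 1 = 1" "eval_at t (f + g) = eval_at t f + eval_at t g"
  "eval_at t (f * g) = eval_at t f * eval_at t g" "eval_at t (pCons c f) = \<iota> c + t * eval_at t f"
  "eval_at t 0 = 0"
  by (simp_all add: eval_at_def map_poly_add map_poly_mult map_poly_pCons)

lemma coprime_quotient:
  obtains a b where "b \<noteq> 0" "coprime a b" "x * \<iota> b = \<iota> a"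
proof -
  obtain a b where ab: "b \<noteq> 0" "x * \<iota> b = \<iota> a" using quotient by blast
  then have g: "gcd a b \<noteq> 0" by simp
  then obtain a' b' where *: "a = a' * gcd a b" "b = b' * gcd a b" "coprime a' b'"
    using gcd_coprime_exists by blast
  have "x * \<iota> b' * \<iota> (gcd a b) = \<iota> a' * \<iota> (gcd a b)"
    using ab(2) *(1,2) by (metis emb_simps(3) mult.assoc)
  then have "x * \<iota> b' = \<iota> a'" using ab(1) by simp
  moreover have "b' \<noteq> 0" using ab(1) *(2) by auto
  ultimately show ?thesis using that *(3) by blast
qed

text \<open>A unique factorization domain is integrally closed:
  \<open>c * b\<^sup>2 = a\<^sup>2\<close> implies that \<open>b\<close> divides
  \<open>a\<close>.\<close>

lemma square_in_ring:
  assumes "\<iota> c = s\<^sup>2"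
  shows "\<exists>e. c = e\<^sup>2"
proof -
  obtain a b where ab: "b \<noteq> 0" "s * \<iota> b = \<iota> a" using quotient by blast
  have "\<iota> (c * b\<^sup>2) = \<iota> (a\<^sup>2)"
    unfolding power2_eq_square by (simp add: assms power2_eq_square flip: ab(2))
  then have c: "c * b\<^sup>2 = a\<^sup>2" by (simp only: emb_simps(4))
  then have "b\<^sup>2 dvd a\<^sup>2" by (metis dvd_triv_right)
  then have "b dvd a" by simp
  then obtain e where "a = b * e" by (auto elim!: dvdE)
  then have "b\<^sup>2 * c = b\<^sup>2 * e\<^sup>2" using c by (simp add: power_mult_distrib mult.commute)
  then show ?thesis using ab(1) by auto
qed

text \<open>Division by \<open>[:- u, v:]\<close> is possible after multiplication by a power of \<open>v\<close>, and such a power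
  is coprime to \<open>[:- u, v:]\<close>.\<close>

lemma linear_dvd_of_root:
  assumes v: "v \<noteq> 0" "coprime u v" "t * \<iota> v = \<iota> u" and root: "eval_at t f = 0"
  shows "[:- u, v:] dvd f"
proof -
  \<comment> \<open>Pseudo-division by a linear polynomial, carried out along the coefficients as in
    Horner's scheme.\<close>
  have "\<exists>g r. smult (v ^ degree f) f = [:- u, v:] * g + [:r:]"
    if "f \<noteq> 0" for f
    using that
  proof (induction f)
    case (pCons c f)
    show ?case
    proof (cases "f = 0")
      case True
      then show ?thesis by (intro exI[of _ 0] exI[of _ c]) simp
    next
      case False
      then obtain g r where gr: "smult (v ^ degree f) f = [:- u, v:] * g + [:r:]"
        using pCons.IH by blast
      have "smult (v ^ degree (pCons c f)) (pCons c f) =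
          smult v (pCons 0 (smult (v ^ degree f) f)) + [:v ^ degree (pCons c f) * c:]"
        using False by simp
      also have "\<dots> = [:- u, v:] * (smult v (pCons 0 g) + [:r:]) +
          [:u * r + v ^ degree (pCons c f) * c:]"
        unfolding gr by (simp add: algebra_simps smult_diff_right)
      finally show ?thesis by blast
    qed
  qed simp
  then obtain n g r where gr: "smult (v ^ n) f = [:- u, v:] * g + [:r:]"
    by (metis add.right_neutral mult_zero_right pCons_0_0 smult_0_right)
  have "eval_at t (smult (v ^ n) f) = 0"
    using root eval_at_simps(3)[of t "[:v ^ n:]" f] by simp
  then have "r = 0"
    unfolding gr eval_at_simps using v(3) by simp
  then have "[:v:] ^ n * f = [:- u, v:] * g"
    using gr by (simp add: poly_const_pow)
  then have dvd: "[:- u, v:] dvd [:v:] ^ n * f" by (metis dvd_triv_left)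
  have "coprime [:- u, v:] [:v:]"
  proof (rule coprimeI)
    fix h
    assume h: "h dvd [:- u, v:]" "h dvd [:v:]"
    have "degree h \<le> degree [:v:]" using h(2) v(1) by (intro dvd_imp_degree_le) auto
    then obtain h0 where h0: "h = [:h0:]" using degree_eq_zeroE by auto
    have "h0 dvd u" "h0 dvd v" using h(1) unfolding h0 const_poly_dvd_iff
      by (auto simp: coeff_pCons split: nat.splits)
    then have "is_unit h0" using v(2) by (meson coprime_common_divisor)
    then show "is_unit h" by (simp add: h0 is_unit_const_poly_iff)
  qed
  then have "coprime [:- u, v:] ([:v:] ^ n)" by simp
  then show ?thesis using dvd by (simp add: coprime_dvd_mult_right_iff)
qed

text \<open>A common zero \<open>t\<close>, written as \<open>u / v\<close> in lowest terms, would
  give the common factor \<open>[:- u, v:]\<close> of degree 1.\<close>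

lemma eval_at_coprime:
  assumes "coprime f g" "eval_at t f = 0"
  shows "eval_at t g \<noteq> 0"
proof
  assume g: "eval_at t g = 0"
  obtain u v where v: "v \<noteq> 0" "coprime u v" "t * \<iota> v = \<iota> u" by (rule coprime_quotient)
  have "[:- u, v:] dvd f" "[:- u, v:] dvd g" using linear_dvd_of_root[OF v] assms(2) g by blast+
  then have "is_unit [:- u, v:]" using assms(1) by (meson coprime_common_divisor)
  then show False using v(1) by (auto simp: is_unit_poly_iff)
qed

lemma clear_denominators:
  obtains c p where "c \<noteq> 0" "smult (\<iota> c) f = map_poly \<iota> p"
proof -
  have "\<exists>c p. c \<noteq> 0 \<and> smult (\<iota> c) f = map_poly \<iota> p"
  proof (induction f)
    case 0
    show ?case by (intro exI[of _ 1] exI[of _ 0]) simp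
  next
    case (pCons x f)
    then obtain c p where cp: "c \<noteq> 0" "smult (\<iota> c) f = map_poly \<iota> p" by blast
    obtain a b where ab: "b \<noteq> 0" "x * \<iota> b = \<iota> a" using quotient by blast
    have "smult (\<iota> (c * b)) (pCons x f) = pCons (\<iota> c * \<iota> a) (smult (\<iota> b) (smult (\<iota> c) f))"
      by (simp add: mult.commute flip: ab(2))
    also have "\<dots> = map_poly \<iota> (pCons (c * a) (smult b p))"
      unfolding cp(2) by (simp add: map_poly_pCons map_poly_smult)
    finally show ?case using cp(1) ab(1) by (intro exI[of _ "c * b"]) auto
  qed
  then show ?thesis using that by blast
qed

lemma ratfun_quotient:
  obtains p q where "q \<noteq> 0" "x * ratfun \<iota> q = ratfun \<iota> p"
proof -
  obtain f g where fg: "x = Fract f g" "g \<noteq> 0" using Fract_cases by metis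
  obtain c p where p: "c \<noteq> 0" "smult (\<iota> c) f = map_poly \<iota> p" by (rule clear_denominators)
  obtain d q where q: "d \<noteq> 0" "smult (\<iota> d) g = map_poly \<iota> q" by (rule clear_denominators)
  have "x * to_fract g = to_fract f" using fg by (simp add: Fract_conv_to_fract)
  then have "x * to_fract ([:\<iota> c:] * ([:\<iota> d:] * g)) = to_fract ([:\<iota> d:] * ([:\<iota> c:] * f))"
    by (simp only: to_fract_mult) (simp add: algebra_simps)
  then have "x * to_fract (map_poly \<iota> (smult c q)) = to_fract (map_poly \<iota> (smult d p))"
    by (simp add: p q map_poly_smult)
  moreover have "smult c q \<noteq> 0" using p(1) q fg(2) by auto
  ultimately show ?thesis using that unfolding ratfun_def by blast
qed

lemma has_value_at_ratfun: "has_value_at t (ratfun \<iota> f) (eval_at t f)"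
  unfolding ratfun_def eval_at_def by (rule has_value_at_to_fract)

end

lemma fraction_embedding_integers:
  fixes \<iota> :: "'r::{factorial_ring_gcd,semiring_gcd_mult_normalize} \<Rightarrow> 'k::field_char_0"
  assumes K: "number_field TYPE('k)" and emb: "ring_embedding \<iota>"
    and OR: "carrier integer_ring \<subseteq> range \<iota>"
  shows "fraction_embedding \<iota>"
proof -
  interpret embedded_ring \<iota> by standard (fact emb)
  show ?thesis
  proof
    fix x :: 'k
    obtain c :: int where c: "c \<noteq> 0" "algebraic_int (of_int c * x)"
      using algebraic_int_multiple[OF number_field_algebraic[OF K]] .
    then obtain a where "of_int c * x = \<iota> a" using OR by (auto simp: integer_ring_def)
    then have "x * \<iota> (of_int c) = \<iota> a" by (simp add: mult.commute)
    moreover have "(of_int c :: 'r) \<noteq> 0" using c(1) emb_of_int[of c] by (metis emb_0 of_int_eq_0_iff)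
    ultimately show "\<exists>a b. b \<noteq> 0 \<and> x * \<iota> b = \<iota> a" by blast
  qed
qed

section \<open>Injectivity of specialization\<close>

text \<open>Squared resultant of the linear and the quadratic factor times the discriminant of the
  latter: the two quantities in the hypothesis on \<open>t0\<close>.\<close>

lemma ec_disc_cubic_root:
  "ec_disc (cubic_curve (- (x + s)) (x * s + n) (- (x * n))) =
     16 * ((x\<^sup>2 - s * x + n)\<^sup>2 * (s\<^sup>2 - 4 * n))"
  unfolding ec_disc_cubic by (simp add: algebra_simps eval_nat_numeral)

lemma hcubic_expand:
  "hcubic x s n p q =
     p ^ 3 - (x + s) * p\<^sup>2 * q\<^sup>2 + (x * s + n) * p * q ^ 4 - x * n * q ^ 6"
  unfolding hcubic_def by (simp add: algebra_simps eval_nat_numeral)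

text \<open>The conjugate roots lie in the extension, but their sum and product come from
  \<open>R[t]\<close>: splitting off the monic factor with root \<open>e1\<close> requires no
  division.\<close>

lemma cubic_coefficients:
  fixes j :: "'k::field_char_0 poly fract \<Rightarrow> 'l::field"
  assumes \<iota>: "ring_embedding \<iota>" and j: "ring_embedding j"
    and roots: "map_poly (\<lambda>p. j (ratfun \<iota> p)) [:C, B, A, 1:]
                  = [:- j (ratfun \<iota> e1), 1:] * [:- e, 1:] * [:- ebar, 1:]"
  obtains S N where "A = - (e1 + S)" "B = e1 * S + N" "C = - (e1 * N)"
    "j (ratfun \<iota> (e1\<^sup>2 - S * e1 + N)) =
       (j (ratfun \<iota> e1))\<^sup>2 - (e + ebar) * j (ratfun \<iota> e1) + e * ebar"
    "j (ratfun \<iota> (S\<^sup>2 - 4 * N)) = (e - ebar)\<^sup>2"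
proof -
  define f where "f p = j (ratfun \<iota> p)" for p
  interpret embedded_ring \<iota> by standard (fact \<iota>)
  have "ring_embedding f"
    unfolding f_def by (rule ring_embedding_comp[OF j ring_embedding_ratfun])
  note f = ring_embedding_simps[OF this]
  have "map_poly f [:C, B, A, 1:] = [:- f e1, 1:] * [:- e, 1:] * [:- ebar, 1:]"
    using roots unfolding f_def .
  then have eqs: "f A = - e - f e1 - ebar" "f B = e * f e1 - ebar * (- e - f e1)"
      "f C = - (ebar * (e * f e1))"
    by (simp_all add: map_poly_pCons f)
  have ABC: "f A = - f e1 - e - ebar" "f B = f e1 * (e + ebar) + e * ebar"
      "f C = - (f e1 * (e * ebar))"
    unfolding eqs by (simp_all add: algebra_simps)
  define S N where "S = - A - e1" and "N = B - e1 * S"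
  have S: "f S = e + ebar" by (simp add: S_def f ABC)
  have N: "f N = e * ebar" by (simp add: N_def f ABC S)
  have "f C = f (- (e1 * N))" by (simp add: f ABC N)
  then have "C = - (e1 * N)" by (simp only: f(9))
  moreover have "f (e1\<^sup>2 - S * e1 + N) = (f e1)\<^sup>2 - (e + ebar) * f e1 + e * ebar"
    by (simp add: f S N)
  moreover have "f (S\<^sup>2 - 4 * N) = (e - ebar)\<^sup>2"
    by (simp add: f S N algebra_simps eval_nat_numeral)
  ultimately show ?thesis using that[of S N] by (simp add: S_def N_def f_def)
qed

theorem theorem1p4:
  fixes \<iota> :: "'r::{factorial_ring_gcd, semiring_gcd_mult_normalize} \<Rightarrow> 'k::field_char_0"
    and A B C e1 :: "'r poly"
    and E :: "'k poly fract weierstrass"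
    and j :: "'k poly fract \<Rightarrow> 'l::field"
    and e ebar :: 'l
    and t0 :: 'k
  assumes K: "number_field TYPE('k)"
    and R_sub_K: "ring_embedding \<iota>"
    and O_sub_R: "carrier integer_ring \<subseteq> range \<iota>"
    and R_units: "finitely_generated_group (unit_group :: 'r monoid)"
    and R_class_one: "class_number TYPE('k) = 1 \<Longrightarrow> range \<iota> = carrier integer_ring"
    and E: "E = cubic_curve (ratfun \<iota> A) (ratfun \<iota> B) (ratfun \<iota> C)"
    and E_elliptic: "elliptic_curve E"
    and E_nonconstant: "nonconstant_curve E"
    and E_two_torsion: "card (nontrivial_two_torsion E) = 1"
    and L: "ring_embedding j"
    and roots: "map_poly (\<lambda>p. j (ratfun \<iota> p)) [:C, B, A, 1:]
                  = [:- j (ratfun \<iota> e1), 1:] * [:- e, 1:] * [:- ebar, 1:]"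
    and e_notin: "e \<notin> range j" and ebar_notin: "ebar \<notin> range j"
    and conj: "conjugate_over j e ebar"
    and t0: "\<And>h :: 'r poly. degree h > 0 \<Longrightarrow> squarefree h \<Longrightarrow>
               poly_divides \<iota> j h ((j (ratfun \<iota> e1))^2 - (e + ebar) * j (ratfun \<iota> e1) + e * ebar)
               \<or> poly_divides \<iota> j h ((e - ebar)^2) \<Longrightarrow>
               \<not> (\<exists>s. poly (map_poly \<iota> h) t0 = s^2)"
  shows "elliptic_curve (specialized_curve t0 E) \<and>
         specialization t0 \<in> mon (ec_group E) (ec_group (specialized_curve t0 E))"
proof -
  interpret fraction_embedding \<iota>
    by (rule fraction_embedding_integers[OF K R_sub_K O_sub_R])
  note rf = ring_embedding_simps[OF ring_embedding_ratfun]
  obtain S N where ABC: "A = - (e1 + S)" "B = e1 * S + N" "C = - (e1 * N)"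
    and \<beta>: "j (ratfun \<iota> (e1\<^sup>2 - S * e1 + N)) =
       (j (ratfun \<iota> e1))\<^sup>2 - (e + ebar) * j (ratfun \<iota> e1) + e * ebar"
    and d: "j (ratfun \<iota> (S\<^sup>2 - 4 * N)) = (e - ebar)\<^sup>2"
    using cubic_coefficients[OF R_sub_K L roots] .
  define \<beta>' d' where "\<beta>' = e1\<^sup>2 - S * e1 + N" and "d' = S\<^sup>2 - 4 * N"
  have E': "E = cubic_curve (- (ratfun \<iota> e1 + ratfun \<iota> S)) (ratfun \<iota> e1 * ratfun \<iota> S + ratfun \<iota> N)
      (- (ratfun \<iota> e1 * ratfun \<iota> N))"
    by (simp add: E ABC rf)
  have "ec_disc E = ratfun \<iota> (16 * (\<beta>'\<^sup>2 * d'))"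
    unfolding E' ec_disc_cubic_root by (simp add: \<beta>'_def d'_def rf)
  then have nz: "\<beta>' \<noteq> 0" "d' \<noteq> 0"
    using E_elliptic rf(1) by (auto simp: elliptic_curve_def)
  interpret halving_descent "eval_at t0" e1 S N \<beta>' d'
  proof
    fix D :: "'r poly" and s
    assume D: "squarefree D" "D dvd \<beta>' \<or> D dvd d'" "eval_at t0 D = s\<^sup>2"
    have "poly_divides \<iota> j D (j (ratfun \<iota> z))" if "D dvd z" for z
      using that by (auto simp: poly_divides_def elim!: dvdE)
    \<comment> \<open>The hypothesis on \<open>t0\<close> rules out positive degree; for a constant,
      \<open>square_in_ring\<close> takes the root in \<open>R\<close>.\<close>
    from this[of \<beta>'] this[of d'] have "degree D = 0"
      using t0[of D] D unfolding \<beta>'_def d'_def \<beta> d eval_at_def by auto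
    then obtain c where c: "D = [:c:]" by (rule degree_eq_zeroE)
    then have "\<iota> c = s\<^sup>2" using D(3) by simp
    then obtain u where "c = u\<^sup>2" using square_in_ring by blast
    then have "D = [:u:]\<^sup>2" by (simp add: c power2_eq_square)
    then show "\<exists>\<delta>. D = \<delta>\<^sup>2" ..
  next
    fix u v :: "'r poly"
    assume "is_unit u" "is_unit v" "eval_at t0 u = eval_at t0 v"
    then show "u = v" by (auto simp: is_unit_poly_iff)
  qed (simp_all add: \<beta>'_def[symmetric] d'_def[symmetric] nz eval_at_coprime)
  have ev_nz: "eval_at t0 \<beta>' \<noteq> 0" "eval_at t0 d' \<noteq> 0"
    using ev_nonzero nz by auto
  have spec: "specialized_curve t0 E =
      cubic_curve (eval_at t0 A) (eval_at t0 B) (eval_at t0 C)"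
    by (simp add: E specialized_curve_def cubic_curve_def
        has_value_at_imp_subst_at[OF has_value_at_ratfun]
        has_value_at_imp_subst_at[OF has_value_at_0])
  have "ec_disc (specialized_curve t0 E) = 16 * ((eval_at t0 \<beta>')\<^sup>2 * eval_at t0 d')"
    unfolding spec \<beta>'_def d'_def
    using ec_disc_cubic_root[of "eval_at t0 e1" "eval_at t0 S" "eval_at t0 N"]
    by (simp add: ABC)
  then have ell: "elliptic_curve (specialized_curve t0 E)"
    using ev_nz by (simp add: elliptic_curve_def)
  interpret sc: specialized_cubic t0 "ratfun \<iota> A" "ratfun \<iota> B" "ratfun \<iota> C"
      "eval_at t0 A" "eval_at t0 B" "eval_at t0 C"
    by standard (use ell in \<open>simp_all add: has_value_at_ratfun spec\<close>)
  have "regular_at t0 x" if on: "on_cubic (ratfun \<iota> A) (ratfun \<iota> B) (ratfun \<iota> C) x y" for x y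
  proof -
    obtain p q where pq: "q \<noteq> 0" "x * ratfun \<iota> q = ratfun \<iota> p" by (rule ratfun_quotient)
    obtain r s where rs: "s \<noteq> 0" "y * ratfun \<iota> s = ratfun \<iota> r" by (rule ratfun_quotient)
    \<comment> \<open>The common denominator \<open>q * s\<close> gives
      \<open>x = p0 / q0\<^sup>2\<close> and \<open>y = r0 / q0 ^ 3\<close>, possibly not in lowest
      terms.\<close>
    define p0 q0 r0 where "p0 = p * q * s\<^sup>2" and "q0 = q * s" and "r0 = r * q ^ 3 * s\<^sup>2"
    have q0: "q0 \<noteq> 0" using pq rs by (simp add: q0_def)
    have x0: "ratfun \<iota> p0 = x * (ratfun \<iota> q0)\<^sup>2" and y0: "ratfun \<iota> r0 = y * (ratfun \<iota> q0) ^ 3"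
      by (simp_all add: p0_def q0_def r0_def rf power_mult_distrib eval_nat_numeral
          flip: pq(2) rs(2))
    have "ratfun \<iota> (r0\<^sup>2) = ratfun \<iota> (hcubic e1 S N p0 q0)"
    proof -
      have y2: "y\<^sup>2 = x ^ 3 + (- ratfun \<iota> e1 - ratfun \<iota> S) * x\<^sup>2
          + (ratfun \<iota> e1 * ratfun \<iota> S + ratfun \<iota> N) * x - ratfun \<iota> e1 * ratfun \<iota> N"
        using on unfolding on_cubic_def ABC rf by simp
      have "ratfun \<iota> (r0\<^sup>2) = y\<^sup>2 * (ratfun \<iota> q0) ^ 6"
        by (simp add: rf y0 power_mult_distrib flip: power_mult)
      also have "\<dots> = ratfun \<iota> (hcubic e1 S N p0 q0)"
        unfolding y2 hcubic_expand
        by (simp add: rf x0 algebra_simps eval_nat_numeral)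
      finally show ?thesis .
    qed
    then have r0: "r0\<^sup>2 = hcubic e1 S N p0 q0" by (simp only: rf(9))
    obtain a b where ab: "eval_at t0 b \<noteq> 0" "p0 * b = a * q0\<^sup>2"
      using no_nonregular_solution[OF q0 r0] .
    have "ratfun \<iota> (p0 * b) = ratfun \<iota> (a * q0\<^sup>2)" using ab(2) by simp
    then have "x * ratfun \<iota> b * (ratfun \<iota> q0)\<^sup>2 = ratfun \<iota> a * (ratfun \<iota> q0)\<^sup>2"
      by (simp add: rf x0 ac_simps)
    moreover have "ratfun \<iota> q0 \<noteq> 0" using q0 rf(1,9) by metis
    ultimately have "x * ratfun \<iota> b = ratfun \<iota> a" by simp
    moreover have "ratfun \<iota> b \<noteq> 0" using ab(1) rf(1,9) by (metis eval_at_simps(5))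
    ultimately have x: "x = ratfun \<iota> a / ratfun \<iota> b" by (simp add: eq_divide_eq)
    show ?thesis unfolding x regular_at_iff
      using has_value_at_divide[OF has_value_at_ratfun has_value_at_ratfun ab(1)] by blast
  qed
  then have "inj_on (specialization t0) (carrier (ec_group E))"
    using sc.inj_on_specialization by (simp add: ec_group_def E)
  moreover have "specialization t0 \<in> hom (ec_group E) (ec_group (specialized_curve t0 E))"
    using sc.specialization_hom unfolding spec unfolding E .
  ultimately show ?thesis using ell by (simp add: mon_def)
qed

end
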